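(* For each $n$ let $\mathcal{C},\mathcal{C}'$ be conjugacy classes of $S_n$ whose elements have $c_j$ (resp. $c'_j$) $j$-cycles. Let $\pi\in\mathcal{C}$, $\pi'\in\mathcal{C}'$ be independent and uniform, and let $N$ be the number of orbits of $\langle\pi,\pi'\rangle$ on $\{1,\dots,n\}$ of size at most $n/2$. Assume $c_1+c'_1=o(n^{2/3})$, $(c_1+c_2^{1/2})(c'_1+{c'_2}^{1/2})=O(n)$, and that there is a constant $\epsilon>0$ with $c_2+c'_2\leq(1-\epsilon)n$. Then \[ \mathbf{P}(N=0)=e^{-\mathbf{E}N}+o(1). \]
   Context: Asymptotic notation is with respect to $n\to\infty$. *)

theory Defs
  imports "HOL-Combinatorics.Permutations" "HOL-Library.Landau_Symbols" Complex_Main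
begin

text \<open>Orbit of x under the group generated by a set fs of permutations of a finite set:
  for permutations of a finite set, forward reachability equals the group orbit.\<close>
definition gen_orbit :: "(nat \<Rightarrow> nat) set \<Rightarrow> nat \<Rightarrow> nat set" where
  "gen_orbit fs x = {y. (x, y) \<in> {(a, f a) | a f. f \<in> fs}\<^sup>*}"

definition gen_orbits :: "(nat \<Rightarrow> nat) set \<Rightarrow> nat set \<Rightarrow> nat set set" where
  "gen_orbits fs A = gen_orbit fs ` A"

definition cycle_count :: "nat \<Rightarrow> (nat \<Rightarrow> nat) \<Rightarrow> nat \<Rightarrow> nat" where
  "cycle_count n p j = card {X \<in> gen_orbits {p} {1..n}. card X = j}"

definition conj_class :: "nat \<Rightarrow> (nat \<Rightarrow> nat) \<Rightarrow> (nat \<Rightarrow> nat) set" where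
  "conj_class n p = {s \<circ> p \<circ> inv s | s. s permutes {1..n}}"

definition is_conj_class :: "nat \<Rightarrow> (nat \<Rightarrow> nat) set \<Rightarrow> bool" where
  "is_conj_class n C \<longleftrightarrow> (\<exists>p. p permutes {1..n} \<and> C = conj_class n p)"

definition class_cycles :: "nat \<Rightarrow> (nat \<Rightarrow> nat) set \<Rightarrow> nat \<Rightarrow> nat" where
  "class_cycles n C j = cycle_count n (SOME p. p \<in> C) j"

definition small_orbits :: "nat \<Rightarrow> (nat \<Rightarrow> nat) \<Rightarrow> (nat \<Rightarrow> nat) \<Rightarrow> nat" where
  "small_orbits n p q = card {X \<in> gen_orbits {p, q} {1..n}. real (card X) \<le> real n / 2}"

definition prob_N0 :: "nat \<Rightarrow> (nat \<Rightarrow> nat) set \<Rightarrow> (nat \<Rightarrow> nat) set \<Rightarrow> real" where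
  "prob_N0 n C C' = real (card {(p, q) \<in> C \<times> C'. small_orbits n p q = 0}) / real (card (C \<times> C'))"

definition exp_N :: "nat \<Rightarrow> (nat \<Rightarrow> nat) set \<Rightarrow> (nat \<Rightarrow> nat) set \<Rightarrow> real" where
  "exp_N n C C' = (\<Sum>(p, q) \<in> C \<times> C'. real (small_orbits n p q)) / real (card (C \<times> C'))"

end

theory Submission
  imports Defs
begin

text \<open>
  By conjugation invariance one may fix representatives \<open>p\<close>, \<open>q\<close> of the two classes and study
  the orbits of \<open>p\<close> and \<open>s \<circ> q \<circ> inv s\<close> for a uniform permutation \<open>s\<close>.

  The expected number of common invariant \<open>k\<close>-sets is \<open>f k * f' k / (n choose k)\<close>, where \<open>f k\<close>,
  \<open>f' k\<close> count the invariant \<open>k\<close>-sets of \<open>p\<close> and \<open>q\<close>. Bounding the generating function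
  \<open>\<Sum>k. f k * y ^ k\<close>, a product over the cycles of \<open>p\<close>, at suitable points shows that this
  expectation decays geometrically for \<open>k \<le> n / 2\<close>, so that only orbits of bounded size matter.
  The same estimate shows that any given point lies in an orbit of bounded size with
  probability \<open>o(1)\<close>.

  Let \<open>N\<close> count the orbits of size at most a constant \<open>K\<close> and let \<open>l\<close> be its mean. The function
  \<open>exp (- l * u) * E (u ^ N)\<close> equals \<open>P (N = 0)\<close> at \<open>u = 0\<close> and \<open>exp (- l)\<close> at \<open>u = 1\<close>, and its
  derivative is at most \<open>\<bar>E (N * u ^ (N - 1)) - l * E (u ^ N)\<bar>\<close>. Given a small orbit \<open>A\<close>, resampling \<open>s\<close>
  outside \<open>A\<close> can be coupled with a uniform permutation such that only boundedly many values differ;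
  hence conditioning on \<open>A\<close> being an orbit rarely affects the number of the other small orbits, and
  this difference is \<open>o(1)\<close>.
\<close>

section \<open>Orbits and invariant sets\<close>

definition invariant :: "('a \<Rightarrow> 'a) set \<Rightarrow> 'a set \<Rightarrow> bool" where
  "invariant F X \<longleftrightarrow> (\<forall>f\<in>F. f ` X \<subseteq> X)"

lemma invariantD: "invariant F X \<Longrightarrow> f \<in> F \<Longrightarrow> x \<in> X \<Longrightarrow> f x \<in> X"
  by (auto simp: invariant_def)

lemma gen_orbit_refl: "x \<in> gen_orbit F x"
  by (simp add: gen_orbit_def)

lemma invariant_gen_orbit: "invariant F (gen_orbit F x)"
  unfolding invariant_def gen_orbit_def
  by (auto intro: rtrancl_into_rtrancl)

lemma gen_orbit_subset:
  assumes "invariant F X" "x \<in> X"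
  shows "gen_orbit F x \<subseteq> X"
proof
  fix y assume "y \<in> gen_orbit F x"
  then have "(x, y) \<in> {(a, f a) | a f. f \<in> F}\<^sup>*" by (simp add: gen_orbit_def)
  then show "y \<in> X"
    by induction (use assms in \<open>auto simp: invariant_def\<close>)
qed

text \<open>An injective self-map of a finite set is onto. So closure under the generators already
  means closure under the group they generate, and \<open>invariant\<close> can be stated with
  inclusion only.\<close>

lemma invariant_permutes_iff:
  assumes "f permutes U" "finite U" "X \<subseteq> U"
  shows "invariant {f} X \<longleftrightarrow> f ` X = X"
proof -
  have "finite X" using assms finite_subset by blast
  moreover have "inj_on f X" using assms(1) permutes_inj_on by blast
  ultimately have "f ` X \<subseteq> X \<Longrightarrow> f ` X = X"
    by (simp add: card_image card_subset_eq)
  then show ?thesis by (auto simp: invariant_def)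
qed

text \<open>Every generator maps \<open>Y\<close> onto itself and is injective, so no point outside
  \<open>Y\<close> can be moved into it.\<close>

lemma invariant_Diff:
  assumes "finite U" "\<forall>f\<in>F. f permutes U" "X \<subseteq> U" "Y \<subseteq> X" "invariant F X" "invariant F Y"
  shows "invariant F (X - Y)"
  unfolding invariant_def
proof (intro ballI subsetI)
  fix f z assume f: "f \<in> F" and "z \<in> f ` (X - Y)"
  then obtain w where w: "w \<in> X" "w \<notin> Y" "z = f w" by blast
  have fY: "f ` Y = Y"
    using invariant_permutes_iff[of f U Y] assms f by (auto simp: invariant_def)
  have "f w \<notin> Y"
    using w(2) fY inj_image_mem_iff[OF permutes_inj[OF assms(2)[rule_format, OF f]], of w Y] by auto
  then show "z \<in> X - Y" using w invariantD[OF assms(5) f] by auto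
qed

text \<open>Orbits are the minimal nonempty invariant sets. This form mentions the generators only
  through their values on subsets of \<open>X\<close>, which later allows an orbit to be carried
  over to another permutation that agrees on \<open>X\<close>.\<close>

lemma gen_orbits_iff:
  assumes "finite U" "\<forall>f\<in>F. f permutes U"
  shows "X \<in> gen_orbits F U \<longleftrightarrow>
    X \<subseteq> U \<and> X \<noteq> {} \<and> invariant F X \<and> (\<forall>Y\<subseteq>X. Y \<noteq> {} \<longrightarrow> invariant F Y \<longrightarrow> Y = X)"
    (is "?L \<longleftrightarrow> ?R")
proof
  have U: "invariant F U" using assms(2) by (auto simp: invariant_def permutes_in_image)
  assume ?L
  then obtain x where x: "x \<in> U" "X = gen_orbit F x" by (auto simp: gen_orbits_def)
  have XU: "X \<subseteq> U" using gen_orbit_subset[OF U x(1)] x by simp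
  have "Y = X" if Y: "Y \<subseteq> X" "Y \<noteq> {}" "invariant F Y" for Y
  proof (cases "x \<in> Y")
    case True
    then show ?thesis using gen_orbit_subset[OF Y(3) True] x Y by auto
  next
    \<comment> \<open>If the orbit of \<open>x\<close> had an invariant part \<open>Y\<close>
      missing \<open>x\<close>, then \<open>X - Y\<close> would be an invariant set containing
      \<open>x\<close>, hence all of \<open>X\<close>.\<close>
    case False
    have "invariant F (X - Y)"
      using invariant_Diff[OF assms XU Y(1) _ Y(3)] x invariant_gen_orbit by blast
    then have "X \<subseteq> X - Y"
      using gen_orbit_subset[of F "X - Y" x] False x gen_orbit_refl by auto
    then show ?thesis using Y by auto
  qed
  moreover have "X \<noteq> {}" using x gen_orbit_refl by blast
  moreover have "invariant F X" using x invariant_gen_orbit by simp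
  ultimately show ?R using XU by (intro conjI allI impI)
next
  assume R: ?R
  then have "X \<noteq> {}" by (elim conjE)
  then obtain x where x: "x \<in> X" by blast
  have "invariant F X" using R by (elim conjE)
  then have "gen_orbit F x \<subseteq> X" by (rule gen_orbit_subset[OF _ x])
  moreover have "gen_orbit F x \<noteq> {}" using gen_orbit_refl[of x F] by blast
  moreover have min: "\<forall>Y\<subseteq>X. Y \<noteq> {} \<longrightarrow> invariant F Y \<longrightarrow> Y = X" using R by (elim conjE)
  ultimately have "gen_orbit F x = X"
    using min[rule_format, OF _ _ invariant_gen_orbit] by blast
  moreover have "X \<subseteq> U" using R by (elim conjE)
  ultimately show ?L using x by (auto simp: gen_orbits_def)
qed

lemma gen_orbits_subset:
  assumes "finite U" "\<forall>f\<in>F. f permutes U" "X \<in> gen_orbits F U"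
  shows "X \<subseteq> U" "X \<noteq> {}" "invariant F X" "finite X"
  using assms(3) finite_subset[OF _ assms(1)] unfolding gen_orbits_iff[OF assms(1,2)] by auto

lemma finite_gen_orbits: "finite U \<Longrightarrow> finite (gen_orbits F U)"
  by (simp add: gen_orbits_def)

text \<open>The intersection with \<open>Z\<close> is invariant and nonempty, so minimality of
  \<open>X\<close> applies to it.\<close>

lemma gen_orbits_eqI:
  assumes "finite U" "\<forall>f\<in>F. f permutes U"
    "X \<in> gen_orbits F U" "invariant F Z" "x \<in> X" "x \<in> Z"
  shows "X \<subseteq> Z"
proof -
  have "invariant F (X \<inter> Z)"
    using assms(4) gen_orbits_subset(3)[OF assms(1,2,3)] unfolding invariant_def by blast
  then have "X \<inter> Z = X"
    using assms(3,5,6) unfolding gen_orbits_iff[OF assms(1,2)]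
    by (metis Int_iff empty_iff inf_le1)
  then show ?thesis by auto
qed

lemma gen_orbits_disjoint:
  assumes "finite U" "\<forall>f\<in>F. f permutes U"
    "X \<in> gen_orbits F U" "Y \<in> gen_orbits F U" "X \<noteq> Y"
  shows "X \<inter> Y = {}"
proof (rule ccontr)
  assume "X \<inter> Y \<noteq> {}"
  then obtain x where "x \<in> X" "x \<in> Y" by blast
  then show False
    using gen_orbits_eqI[OF assms(1,2,3) gen_orbits_subset(3)[OF assms(1,2,4)]]
      gen_orbits_eqI[OF assms(1,2,4) gen_orbits_subset(3)[OF assms(1,2,3)]] assms(5) by blast
qed

lemma invariant_Union_gen_orbits:
  assumes "Z \<subseteq> U" "invariant F Z"
  shows "Z = \<Union>{X \<in> gen_orbits F U. X \<subseteq> Z}"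
proof
  show "Z \<subseteq> \<Union>{X \<in> gen_orbits F U. X \<subseteq> Z}"
  proof
    fix x assume x: "x \<in> Z"
    then have "gen_orbit F x \<in> gen_orbits F U" using assms by (auto simp: gen_orbits_def)
    then show "x \<in> \<Union>{X \<in> gen_orbits F U. X \<subseteq> Z}"
      using gen_orbit_subset[OF assms(2) x] gen_orbit_refl by blast
  qed
qed auto

lemma card_Union_gen_orbits:
  assumes "finite U" "\<forall>f\<in>F. f permutes U" "S \<subseteq> gen_orbits F U"
  shows "card (\<Union>S) = (\<Sum>X\<in>S. card X)"
proof (rule card_Union_disjoint)
  show "pairwise disjnt S"
    using gen_orbits_disjoint[OF assms(1,2)] assms(3) unfolding pairwise_def disjnt_def by blast
  show "finite X" if "X \<in> S" for X
    using gen_orbits_subset(4)[OF assms(1,2)] assms(3) that by blast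
qed

lemma sum_card_gen_orbits:
  assumes "finite U" "\<forall>f\<in>F. f permutes U"
  shows "(\<Sum>X\<in>gen_orbits F U. card X) = card U"
proof -
  have U: "invariant F U" using assms(2) by (auto simp: invariant_def permutes_in_image)
  have "card (\<Union>(gen_orbits F U)) = (\<Sum>X\<in>gen_orbits F U. card X)"
    using card_Union_gen_orbits[OF assms order_refl] .
  moreover have "\<Union>(gen_orbits F U) = U"
    using invariant_Union_gen_orbits[OF order_refl U] gen_orbits_subset(1)[OF assms] by blast
  ultimately show ?thesis by simp
qed

section \<open>The generating function of invariant sets as a product over cycles\<close>

text \<open>An invariant set is the disjoint union of the cycles inside it, so invariant sets inject
  into sets of cycles and \<open>y ^ card Z\<close> factors over those cycles. Expanding the product
  gives the sum over all sets of cycles.\<close>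

lemma sum_invariant_le_prod:
  fixes y :: real
  assumes fin: "finite U" and p: "p permutes U" and y: "0 < y"
  shows "(\<Sum>Z | Z \<subseteq> U \<and> invariant {p} Z. y ^ card Z) \<le> (\<Prod>X\<in>gen_orbits {p} U. 1 + y ^ card X)"
proof -
  let ?G = "gen_orbits {p} U"
  let ?I = "{Z. Z \<subseteq> U \<and> invariant {p} Z}"
  let ?c = "\<lambda>Z. {X \<in> ?G. X \<subseteq> Z}"
  have pp: "\<forall>f\<in>{p}. f permutes U" using p by simp
  have inj: "inj_on ?c ?I"
    by (rule inj_on_inverseI[where g = Union])
      (simp add: invariant_Union_gen_orbits[symmetric])
  have *: "y ^ card Z = (\<Prod>X\<in>?c Z. y ^ card X)" if "Z \<in> ?I" for Z
  proof -
    have "card (\<Union>(?c Z)) = (\<Sum>X\<in>?c Z. card X)"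
      by (rule card_Union_gen_orbits[OF fin pp]) auto
    then show ?thesis
      using that by (simp add: power_sum invariant_Union_gen_orbits[symmetric])
  qed
  have "(\<Sum>Z\<in>?I. y ^ card Z) = (\<Sum>Z\<in>?I. \<Prod>X\<in>?c Z. y ^ card X)"
    using * by (intro sum.cong) auto
  also have "\<dots> = (\<Sum>S\<in>?c ` ?I. \<Prod>X\<in>S. y ^ card X)"
    using inj by (simp add: sum.reindex)
  also have "\<dots> \<le> (\<Sum>S\<in>Pow ?G. \<Prod>X\<in>S. y ^ card X)"
    using y finite_gen_orbits[OF fin] by (intro sum_mono2) (auto intro!: prod_nonneg)
  also have "\<dots> = (\<Prod>X\<in>?G. y ^ card X + 1)"
    using prod_add[OF finite_gen_orbits[OF fin, of "{p}"], of "\<lambda>X. y ^ card X" "\<lambda>_. 1"] by simp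
  finally show ?thesis by (simp add: add.commute)
qed

text \<open>Removing the orbit of \<open>x\<close> costs the factor \<open>y ^ card orbit \<le> y\<close>.\<close>

lemma sum_invariant_containing_le_prod:
  fixes y :: real
  assumes fin: "finite U" and p: "p permutes U" and y: "0 < y" "y \<le> 1" and x: "x \<in> U"
  shows "(\<Sum>Z | Z \<subseteq> U \<and> invariant {p} Z \<and> x \<in> Z. y ^ card Z)
    \<le> y * (\<Prod>X\<in>gen_orbits {p} U. 1 + y ^ card X)"
proof -
  let ?O = "gen_orbit {p} x"
  let ?I = "{Z. Z \<subseteq> U \<and> invariant {p} Z}"
  let ?J = "{Z. Z \<subseteq> U \<and> invariant {p} Z \<and> x \<in> Z}"
  have pp: "\<forall>f\<in>{p}. f permutes U" using p by simp
  have O: "?O \<in> gen_orbits {p} U" using x by (auto simp: gen_orbits_def)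
  have finO: "finite ?O" "?O \<noteq> {}" using gen_orbits_subset[OF fin pp O] by auto
  have sub: "?O \<subseteq> Z" if "Z \<in> ?J" for Z using that gen_orbit_subset by auto
  have inj: "inj_on (\<lambda>Z. Z - ?O) ?J"
    by (rule inj_on_inverseI[where g = "\<lambda>Z. Z \<union> ?O"]) (use sub in blast)
  have mem: "Z - ?O \<in> ?I" if "Z \<in> ?J" for Z
    using invariant_Diff[OF fin pp, where X = Z and Y = ?O] sub[OF that] that invariant_gen_orbit by auto
  have "y ^ card Z \<le> y * y ^ card (Z - ?O)" if "Z \<in> ?J" for Z
  proof -
    have "card Z = card ?O + card (Z - ?O)"
      using sub[OF that] finO that fin
      by (metis (no_types, lifting) card_Diff_subset card_mono finite_subset le_add_diff_inverse mem_Collect_eq)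
    moreover have "card ?O \<ge> 1" using finO by (simp add: Suc_leI card_gt_0_iff)
    ultimately have "Suc (card (Z - ?O)) \<le> card Z" by linarith
    then show ?thesis using y power_decreasing[of "Suc (card (Z - ?O))" "card Z" y] by simp
  qed
  then have "(\<Sum>Z\<in>?J. y ^ card Z) \<le> (\<Sum>Z\<in>?J. y * y ^ card (Z - ?O))"
    by (intro sum_mono) auto
  also have "\<dots> = y * (\<Sum>Z\<in>(\<lambda>Z. Z - ?O) ` ?J. y ^ card Z)"
    using inj by (simp add: sum.reindex sum_distrib_left)
  also have "\<dots> \<le> y * (\<Sum>Z\<in>?I. y ^ card Z)"
    using y mem fin by (intro mult_left_mono sum_mono2) auto
  also have "\<dots> \<le> y * (\<Prod>X\<in>gen_orbits {p} U. 1 + y ^ card X)"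
    using sum_invariant_le_prod[OF fin p] y by (intro mult_left_mono) auto
  finally show ?thesis .
qed

section \<open>Counting permutations with prescribed images\<close>

text \<open>The complements of \<open>D\<close> and of its image have equal size, so any bijection
  between them completes \<open>f\<close>.\<close>

lemma ex_permutes_extending:
  assumes "finite U" "D \<subseteq> U" "inj_on f D" "f ` D \<subseteq> U"
  shows "\<exists>r. r permutes U \<and> (\<forall>x\<in>D. r x = f x)"
proof -
  have "card (U - D) = card (U - f ` D)"
    using assms by (simp add: card_Diff_subset card_image finite_subset)
  then obtain g where g: "bij_betw g (U - D) (U - f ` D)"
    using assms(1) by (meson finite_Diff finite_same_card_bij)
  define r where "r x = (if x \<in> D then f x else if x \<in> U then g x else x)" for x
  have "bij_betw r D (f ` D)"
    using assms(3) by (subst bij_betw_cong[of _ _ f]) (auto simp: r_def inj_on_imp_bij_betw)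
  moreover have "bij_betw r (U - D) (U - f ` D)"
    using g by (subst bij_betw_cong[of _ _ g]) (auto simp: r_def)
  ultimately have "bij_betw r (D \<union> (U - D)) (f ` D \<union> (U - f ` D))"
    by (rule bij_betw_combine) auto
  moreover have "D \<union> (U - D) = U" "f ` D \<union> (U - f ` D) = U" using assms by auto
  ultimately have "r permutes U"
    using assms(2) by (intro bij_imp_permutes) (auto simp: r_def)
  then show ?thesis by (auto simp: r_def)
qed

lemma permutes_comp_left_bij:
  assumes "r permutes U"
  shows "bij_betw (\<lambda>s. r \<circ> s) {s. s permutes U} {s. s permutes U}"
proof (rule bij_betw_byWitness[where f' = "\<lambda>s. inv r \<circ> s"])
  show "\<forall>a\<in>{s. s permutes U}. inv r \<circ> (r \<circ> a) = a"
    using permutes_inv_o(2)[OF assms] by (metis comp_assoc fun.map_id0 id_apply)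
  show "\<forall>a\<in>{s. s permutes U}. r \<circ> (inv r \<circ> a) = a"
    using permutes_inv_o(1)[OF assms] by (metis comp_assoc fun.map_id0 id_apply)
qed (auto intro: permutes_compose assms permutes_inv)

lemma permutes_comp_right_bij:
  assumes "r permutes U"
  shows "bij_betw (\<lambda>s. s \<circ> r) {s. s permutes U} {s. s permutes U}"
proof (rule bij_betw_byWitness[where f' = "\<lambda>s. s \<circ> inv r"])
  show "\<forall>a\<in>{s. s permutes U}. a \<circ> r \<circ> inv r = a"
    using permutes_inv_o(1)[OF assms] by (auto simp: comp_assoc)
  show "\<forall>a\<in>{s. s permutes U}. a \<circ> inv r \<circ> r = a"
    using permutes_inv_o(2)[OF assms] by (auto simp: comp_assoc)
qed (auto intro: permutes_compose assms permutes_inv)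

text \<open>Composing with a permutation that carries \<open>Z\<close> to \<open>Z'\<close> shows
  that the count does not depend on the target. The \<open>card U choose k\<close> possible targets
  therefore share all permutations equally.\<close>

lemma card_permutes_image_eq:
  assumes U: "finite U" and Y: "Y \<subseteq> U" "card Y = k" and Z: "Z \<subseteq> U" "card Z = k"
  shows "real (card {s. s permutes U \<and> s ` Y = Z}) = fact (card U) / real (card U choose k)"
proof -
  let ?S = "{s. s permutes U}"
  let ?w = "\<lambda>Z. {s \<in> ?S. s ` Y = Z}"
  let ?P = "{Z. Z \<subseteq> U \<and> card Z = k}"
  have finS: "finite ?S" using U by (rule finite_permutations)
  have w: "card (?w Z') = card (?w Z)" if Z': "Z' \<in> ?P" for Z'
  proof -
    have "\<exists>f. bij_betw f Z Z'"
      using Z' Z U finite_subset by (intro finite_same_card_bij) auto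
    then obtain f where f: "bij_betw f Z Z'" by blast
    obtain r where r: "r permutes U" "\<forall>x\<in>Z. r x = f x"
      using ex_permutes_extending[OF U Z(1), of f] f Z' by (auto simp: bij_betw_def)
    have rZ: "r ` Z = Z'" using r(2) f by (simp add: bij_betw_def)
    have "(r \<circ> s) ` Y = Z' \<longleftrightarrow> s ` Y = Z" for s
      using permutes_inj[OF r(1)] rZ by (metis image_comp inj_image_eq_iff)
    then have "(\<Sum>s\<in>?S. if s ` Y = Z then 1 else 0) = (\<Sum>s\<in>?S. if (r \<circ> s) ` Y = Z' then 1 else (0::nat))"
      by simp
    also have "\<dots> = (\<Sum>s\<in>?S. if s ` Y = Z' then 1 else 0)"
      by (rule sum.reindex_bij_betw[OF permutes_comp_left_bij[OF r(1)]])
    finally show ?thesis using finS by (simp add: sum.If_cases Int_def)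
  qed
  have "fact (card U) = card ?S" using U by (simp add: card_permutations)
  also have "?S = (\<Union>Z'\<in>?P. ?w Z')"
  proof -
    have "s ` Y \<in> ?P" if "s permutes U" for s
      using that Y permutes_image[OF that] permutes_inj_on[OF that, of Y] card_image by blast
    then show ?thesis by blast
  qed
  also have "card \<dots> = (\<Sum>Z'\<in>?P. card (?w Z'))"
    using U finS by (intro card_UN_disjoint) auto
  also have "\<dots> = card ?P * card (?w Z)" using w by simp
  also have "card ?P = card U choose k" using n_subsets[OF U] .
  finally have "fact (card U) = (card U choose k) * card (?w Z)" .
  from arg_cong[OF this, of real]
  have "fact (card U) = real (card U choose k) * real (card (?w Z))" by simp
  moreover have "card U choose k > 0" using Y U by (metis card_mono zero_less_binomial_iff)
  ultimately show ?thesis by (simp add: field_simps)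
qed

lemma card_permutes_apply_eq:
  assumes "finite U" "x \<in> U" "y \<in> U"
  shows "real (card {s. s permutes U \<and> s x = y}) = fact (card U) / real (card U)"
  using card_permutes_image_eq[OF assms(1), of "{x}" 1 "{y}"] assms by simp

text \<open>Linearity of expectation over the pairs in \<open>P\<close> and \<open>Q\<close>: a
  uniform \<open>s\<close> carries a given \<open>Y\<close> to a given \<open>Z\<close> with
  probability \<open>1 / (card U choose k)\<close>.\<close>

lemma sum_card_permutes_pairs:
  fixes P Q :: "'a set set"
  assumes U: "finite U" and P: "P \<subseteq> {Z. Z \<subseteq> U \<and> card Z = k}" and Q: "Q \<subseteq> {Z. Z \<subseteq> U \<and> card Z = k}"
  shows "(\<Sum>s | s permutes U. real (card {Z\<in>P. inv s ` Z \<in> Q}))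
    = fact (card U) * (real (card P) * real (card Q) / real (card U choose k))"
proof -
  let ?S = "{s. s permutes U}"
  have finS: "finite ?S" using U by (rule finite_permutations)
  have "P \<subseteq> Pow U" "Q \<subseteq> Pow U" using P Q by auto
  then have fin: "finite P" "finite Q" using U by (auto intro: finite_subset)
  have eq: "s ` Y = Z \<longleftrightarrow> Y = inv s ` Z" if "s permutes U" for s Y Z
    using permutes_inverses[OF that] by (auto simp: image_image)
  have "real (card {Z\<in>P. inv s ` Z \<in> Q}) = (\<Sum>Z\<in>P. \<Sum>Y\<in>Q. if s ` Y = Z then 1 else 0)"
    if "s \<in> ?S" for s
    using that fin eq by (simp add: sum.If_cases Int_def of_nat_sum[symmetric] sum.delta)
  then have "(\<Sum>s\<in>?S. real (card {Z\<in>P. inv s ` Z \<in> Q}))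
      = (\<Sum>s\<in>?S. \<Sum>Z\<in>P. \<Sum>Y\<in>Q. if s ` Y = Z then 1 else 0)"
    by (intro sum.cong) auto
  also have "\<dots> = (\<Sum>Z\<in>P. \<Sum>Y\<in>Q. \<Sum>s\<in>?S. if s ` Y = Z then 1 else 0)"
    by (subst sum.swap) (intro sum.cong refl sum.swap)
  also have "\<dots> = (\<Sum>Z\<in>P. \<Sum>Y\<in>Q. fact (card U) / real (card U choose k))"
  proof (intro sum.cong refl)
    fix Z Y assume ZY: "Z \<in> P" "Y \<in> Q"
    have "(\<Sum>s\<in>?S. if s ` Y = Z then 1 else (0::real)) = real (card {s. s permutes U \<and> s ` Y = Z})"
      using finS by (simp add: sum.If_cases Int_def)
    then show "(\<Sum>s\<in>?S. if s ` Y = Z then 1 else 0) = fact (card U) / real (card U choose k)"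
      using card_permutes_image_eq[OF U, of Y k Z] ZY P Q by auto
  qed
  finally show ?thesis by simp
qed

section \<open>Conditioning on an orbit\<close>

text \<open>\<open>p\<close> and \<open>q\<close> stand for representatives of the two classes, and
  \<open>K\<close> is the size up to which an orbit counts as small. Randomness comes only from
  \<open>s\<close>, uniform in \<open>S\<close>; averages are kept as sums over \<open>S\<close>,
  without the factor \<open>1 / fact (card U)\<close>.\<close>

locale perm_pair =
  fixes U :: "nat set" and p q :: "nat \<Rightarrow> nat" and K :: nat
  assumes finU: "finite U" and p: "p permutes U" and q: "q permutes U"
begin

definition "S = {s. s permutes U}"
definition "cj s = s \<circ> q \<circ> inv s"
definition "orbs s = gen_orbits {p, cj s} U"
definition "small s = {X \<in> orbs s. card X \<le> K}"
definition "N s = card (small s)"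

lemma S_iff: "s \<in> S \<longleftrightarrow> s permutes U"
  by (simp add: S_def)

lemma finS: "finite S"
  unfolding S_def using finU by (rule finite_permutations)

lemma cardS: "card S = fact (card U)"
  unfolding S_def using finU by (simp add: card_permutations)

lemma cj_permutes: "s \<in> S \<Longrightarrow> cj s permutes U"
  unfolding cj_def S_iff using q by (intro permutes_compose permutes_inv)

lemma comp_S: "s \<in> S \<Longrightarrow> t \<in> S \<Longrightarrow> s \<circ> t \<in> S"
  unfolding S_iff by (rule permutes_compose)

lemma inv_S: "s \<in> S \<Longrightarrow> inv s \<in> S"
  unfolding S_iff by (rule permutes_inv)

lemma S_inv: assumes "s \<in> S" shows "s (inv s x) = x" "inv s (s x) = x"
  using assms permutes_inverses[of s U] by (simp_all add: S_iff)

lemma inv_comp_S: "s \<in> S \<Longrightarrow> t \<in> S \<Longrightarrow> inv (s \<circ> t) = inv t \<circ> inv s"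
  unfolding S_iff by (intro o_inv_distrib permutes_bij)

lemma orbs_permutes: "s \<in> S \<Longrightarrow> \<forall>f\<in>{p, cj s}. f permutes U"
  using p cj_permutes by auto

lemma orbs_iff:
  assumes "s \<in> S"
  shows "X \<in> orbs s \<longleftrightarrow> X \<subseteq> U \<and> X \<noteq> {} \<and> invariant {p, cj s} X \<and>
    (\<forall>Y\<subseteq>X. Y \<noteq> {} \<longrightarrow> invariant {p, cj s} Y \<longrightarrow> Y = X)"
  unfolding orbs_def by (rule gen_orbits_iff[OF finU orbs_permutes[OF assms]])

lemma orbsD:
  assumes "s \<in> S" "X \<in> orbs s"
  shows "X \<subseteq> U" "X \<noteq> {}" "invariant {p} X" "invariant {cj s} X" "finite X"
proof -
  note X = gen_orbits_subset[OF finU orbs_permutes[OF assms(1)] assms(2)[unfolded orbs_def]]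
  show "X \<subseteq> U" "X \<noteq> {}" "finite X" by (rule X)+
  show "invariant {p} X" "invariant {cj s} X" using X(3) unfolding invariant_def by blast+
qed

lemma finite_orbs: "finite (orbs s)"
  unfolding orbs_def by (rule finite_gen_orbits[OF finU])

lemma finite_small: "finite (small s)"
  unfolding small_def using finite_orbs by simp

lemma smallD:
  assumes "s \<in> S" "X \<in> small s"
  shows "X \<in> orbs s" "X \<subseteq> U" "X \<noteq> {}" "finite X" "card X \<le> K"
proof -
  show 1: "X \<in> orbs s" and "card X \<le> K" using assms(2) by (simp_all add: small_def)
  show "X \<subseteq> U" "X \<noteq> {}" "finite X" by (rule orbsD[OF assms(1) 1])+
qed

lemma small_disjoint:
  assumes "s \<in> S" "X \<in> small s" "Y \<in> small s" "X \<noteq> Y"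
  shows "X \<inter> Y = {}"
  using smallD(1)[OF assms(1,2)] smallD(1)[OF assms(1,3)] assms(4)
  unfolding orbs_def by (rule gen_orbits_disjoint[OF finU orbs_permutes[OF assms(1)]])

text \<open>For \<open>x\<close> in \<open>X\<close> the point \<open>cj s x\<close> is again in
  \<open>X\<close>, so \<open>inv s\<close> and \<open>inv t\<close> agree at both ends and
  \<open>cj s x = cj t x\<close>. Minimal invariance of \<open>X\<close> depends on these values
  alone.\<close>

lemma orbs_transfer:
  assumes "s \<in> S" "t \<in> S" "X \<in> orbs s" and eq: "\<And>x. x \<in> X \<Longrightarrow> inv s x = inv t x"
  shows "X \<in> orbs t"
proof -
  have cj: "cj t x = cj s x" if x: "x \<in> X" for x
  proof -
    have "cj s x \<in> X" using invariantD[OF orbsD(4)[OF assms(1,3)]] x by auto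
    then have "inv t (cj s x) = q (inv t x)"
      using eq[of "cj s x"] eq[OF x] S_inv[OF assms(1)] by (simp add: cj_def)
    then have "t (inv t (cj s x)) = t (q (inv t x))" by (rule arg_cong)
    then show ?thesis by (simp add: S_inv(1)[OF assms(2)] cj_def[of t])
  qed
  have inv: "invariant {p, cj t} Y \<longleftrightarrow> invariant {p, cj s} Y" if "Y \<subseteq> X" for Y
    using that cj by (auto simp: invariant_def subset_iff)
  have X: "X \<subseteq> U" "X \<noteq> {}" "invariant {p, cj s} X"
      "\<forall>Y\<subseteq>X. Y \<noteq> {} \<longrightarrow> invariant {p, cj s} Y \<longrightarrow> Y = X"
    using assms(3)[unfolded orbs_iff[OF assms(1)]] by - (elim conjE, assumption)+
  show ?thesis
    unfolding orbs_iff[OF assms(2)]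
  proof (intro conjI allI impI)
    show "invariant {p, cj t} X" using inv[OF order_refl] X(3) by iprover
    show "Y = X" if "Y \<subseteq> X" "Y \<noteq> {}" "invariant {p, cj t} Y" for Y
      using X(4)[rule_format, OF that(1,2)] that(3) inv[OF that(1)] by iprover
  qed (rule X)+
qed

lemma small_transfer:
  assumes "s \<in> S" "t \<in> S" "X \<in> small s" "\<And>x. x \<in> X \<Longrightarrow> inv s x = inv t x"
  shows "X \<in> small t"
  using orbs_transfer[OF assms(1,2) _ assms(4)] assms(3) by (auto simp: small_def)

lemma small_comp_fixing:
  assumes s: "s \<in> S" and k: "k \<in> S" and A: "A \<in> small s" and fx: "\<And>a. a \<in> A \<Longrightarrow> k a = a"
  shows "A \<in> small (k \<circ> s)"
proof (rule small_transfer[OF s comp_S[OF k s] A])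
  fix x assume "x \<in> A"
  then have "inv k x = x" using fx S_inv(2)[OF k] by metis
  then show "inv s x = inv (k \<circ> s) x" using inv_comp_S[OF k s] by simp
qed

lemma small_comp_fixing_iff:
  assumes s: "s \<in> S" and k: "k \<in> S" and fx: "\<And>a. a \<in> A \<Longrightarrow> k a = a"
  shows "A \<in> small (k \<circ> s) \<longleftrightarrow> A \<in> small s"
proof
  assume A: "A \<in> small (k \<circ> s)"
  have "inv k a = a" if "a \<in> A" for a using fx[OF that] S_inv(2)[OF k] by metis
  then have "A \<in> small (inv k \<circ> (k \<circ> s))"
    by (rule small_comp_fixing[OF comp_S[OF k s] inv_S[OF k] A])
  moreover have "inv k \<circ> (k \<circ> s) = s" using S_inv[OF k] by (auto simp: fun_eq_iff)
  ultimately show "A \<in> small s" by simp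
qed (rule small_comp_fixing[OF s k _ fx])

text \<open>The inverses of \<open>r \<circ> s\<close> and \<open>k \<circ> s\<close> can differ
  only on \<open>A\<close> and its image under \<open>r\<close>. Orbits avoiding both sets transfer
  in either direction; for orbits of \<open>k \<circ> s\<close> other than \<open>A\<close>,
  disjointness from \<open>A\<close> is automatic.\<close>

lemma small_switch:
  assumes s: "s \<in> S" and r: "r \<in> S" and k: "k \<in> S" and A: "A \<in> small s"
    and fx: "\<And>a. a \<in> A \<Longrightarrow> k a = a"
    and agree: "\<And>y. y \<notin> A \<Longrightarrow> r y \<notin> A \<Longrightarrow> k y = r y"
    and 1: "\<And>X. X \<in> small (r \<circ> s) \<Longrightarrow> X \<inter> (A \<union> r ` A) = {}"
    and 2: "\<And>X. X \<in> small (k \<circ> s) - {A} \<Longrightarrow> X \<inter> r ` A = {}"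
  shows "small (r \<circ> s) = small (k \<circ> s) - {A}"
proof -
  have rs: "r \<circ> s \<in> S" and ks: "k \<circ> s \<in> S" using comp_S r k s by auto
  have A': "A \<in> small (k \<circ> s)" using small_comp_fixing[OF s k A fx] .
  have key: "inv (r \<circ> s) x = inv (k \<circ> s) x" if "x \<notin> A" "x \<notin> r ` A" for x
  proof -
    have "inv r x \<notin> A" using that(2) S_inv(1)[OF r] by (metis image_eqI)
    then have "k (inv r x) = x" using agree[of "inv r x"] that(1) S_inv(1)[OF r] by simp
    then have "inv k x = inv r x" using S_inv(2)[OF k] by metis
    then show ?thesis using inv_comp_S r k s by simp
  qed
  show ?thesis
  proof (intro equalityI subsetI)
    fix X assume X: "X \<in> small (r \<circ> s)"
    have "X \<in> small (k \<circ> s)"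
      by (rule small_transfer[OF rs ks X key]) (use 1[OF X] in auto)
    moreover have "X \<noteq> A" using 1[OF X] smallD(3)[OF rs X] by auto
    ultimately show "X \<in> small (k \<circ> s) - {A}" by simp
  next
    fix X assume X: "X \<in> small (k \<circ> s) - {A}"
    then have "X \<inter> A = {}" using small_disjoint[OF ks _ A'] by auto
    with 2[OF X] show "X \<in> small (r \<circ> s)"
      using X by (intro small_transfer[OF ks rs _ key[symmetric]]) auto
  qed
qed

end

lemma abs_power_diff_le_1:
  fixes u :: real
  assumes "0 \<le> u" "u \<le> 1"
  shows "\<bar>u ^ a - u ^ b\<bar> \<le> 1"
proof -
  have "0 \<le> u ^ a" "u ^ a \<le> 1" "0 \<le> u ^ b" "u ^ b \<le> 1"
    using assms by (auto intro: power_le_one)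
  then show ?thesis by linarith
qed

section \<open>The coupling and the size-bias estimate\<close>

context perm_pair
begin

text \<open>For fixed \<open>r\<close> and \<open>A\<close>, composing with \<open>rest r A\<close> permutes the set of all \<open>s\<close> having \<open>A\<close> as an
  orbit. If \<open>r\<close> is uniform then \<open>r \<circ> s\<close> is uniform, while \<open>rest r A \<circ> s\<close> still has the orbit \<open>A\<close>.\<close>

definition "rest r A = (SOME k. k \<in> S \<and> (\<forall>a\<in>A. k a = a) \<and> (\<forall>y\<in>U. y \<notin> A \<longrightarrow> r y \<notin> A \<longrightarrow> k y = r y))"

text \<open>The identity on \<open>A\<close> together with \<open>r\<close> on the points that
  neither lie in \<open>A\<close> nor are sent into \<open>A\<close> is injective: the two parts
  have images inside and outside \<open>A\<close>. Any extension to a permutation serves, and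
  outside \<open>U\<close> both maps are the identity.\<close>

lemma rest:
  assumes r: "r \<in> S" and A: "A \<subseteq> U"
  shows "rest r A \<in> S" "a \<in> A \<Longrightarrow> rest r A a = a"
    "y \<notin> A \<Longrightarrow> r y \<notin> A \<Longrightarrow> rest r A y = r y"
proof -
  let ?D = "A \<union> {y \<in> U. y \<notin> A \<and> r y \<notin> A}"
  let ?f = "\<lambda>y. if y \<in> A then y else r y"
  have rU: "r permutes U" using r by (simp add: S_iff)
  let ?P = "\<lambda>k. k \<in> S \<and> (\<forall>a\<in>A. k a = a) \<and> (\<forall>y\<in>U. y \<notin> A \<longrightarrow> r y \<notin> A \<longrightarrow> k y = r y)"
  have inj: "inj_on ?f ?D"
    using inj_eq[OF permutes_inj[OF rU]] unfolding inj_on_def by (smt (verit) UnE mem_Collect_eq)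
  have img: "?f ` ?D \<subseteq> U" using A permutes_in_image[OF rU] by auto
  have D: "?D \<subseteq> U" using A by auto
  from ex_permutes_extending[OF finU D inj img]
  obtain k where k: "k permutes U" "\<forall>x\<in>?D. k x = ?f x" by (elim exE conjE)
  have "?P k" using k by (auto simp: S_iff)
  then have *: "?P (rest r A)" unfolding rest_def by (rule someI[where P = ?P])
  then show "rest r A \<in> S" "a \<in> A \<Longrightarrow> rest r A a = a" by auto
  show "rest r A y = r y" if "y \<notin> A" "r y \<notin> A"
  proof (cases "y \<in> U")
    case False
    then show ?thesis using * rU by (auto simp: S_iff permutes_def)
  qed (use * that in auto)
qed

lemma sum_comp_left: "k \<in> S \<Longrightarrow> (\<Sum>s\<in>S. g (k \<circ> s)) = (\<Sum>s\<in>S. g s)"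
  unfolding S_def by (intro sum.reindex_bij_betw permutes_comp_left_bij) simp

lemma sum_comp_right: "k \<in> S \<Longrightarrow> (\<Sum>s\<in>S. g (s \<circ> k)) = (\<Sum>s\<in>S. g s)"
  unfolding S_def by (intro sum.reindex_bij_betw permutes_comp_right_bij) simp

lemma small_subset_Pow: "s \<in> S \<Longrightarrow> small s \<subseteq> Pow U"
  using smallD(2) by blast

text \<open>With \<open>A\<close> and \<open>r\<close> fixed, left composition with
  \<open>rest r A\<close> permutes \<open>S\<close> and preserves whether \<open>A\<close> is a
  small orbit. Hence averaging over \<open>s\<close> having \<open>A\<close> as an orbit is
  unaffected by this resampling.\<close>

lemma sum_small_rest:
  fixes h :: "nat set \<Rightarrow> (nat \<Rightarrow> nat) \<Rightarrow> (nat \<Rightarrow> nat) \<Rightarrow> real"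
  shows "(\<Sum>s\<in>S. \<Sum>A\<in>small s. \<Sum>r\<in>S. h A r (rest r A \<circ> s)) = (\<Sum>s\<in>S. \<Sum>A\<in>small s. \<Sum>r\<in>S. h A r s)"
proof -
  have flat: "(\<Sum>s\<in>S. \<Sum>A\<in>small s. \<Sum>r\<in>S. g A r s)
      = (\<Sum>A\<in>Pow U. \<Sum>r\<in>S. \<Sum>s\<in>S. if A \<in> small s then g A r s else 0)"
    for g :: "nat set \<Rightarrow> (nat \<Rightarrow> nat) \<Rightarrow> (nat \<Rightarrow> nat) \<Rightarrow> real"
  proof -
    have "(\<Sum>s\<in>S. \<Sum>A\<in>small s. \<Sum>r\<in>S. g A r s)
        = (\<Sum>s\<in>S. \<Sum>A\<in>Pow U. if A \<in> small s then \<Sum>r\<in>S. g A r s else 0)"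
      using finU by (intro sum.cong[OF refl] sum.mono_neutral_cong_left small_subset_Pow) auto
    also have "\<dots> = (\<Sum>s\<in>S. \<Sum>A\<in>Pow U. \<Sum>r\<in>S. if A \<in> small s then g A r s else 0)"
      by (intro sum.cong refl) simp
    also have "\<dots> = (\<Sum>A\<in>Pow U. \<Sum>s\<in>S. \<Sum>r\<in>S. if A \<in> small s then g A r s else 0)"
      by (rule sum.swap)
    also have "\<dots> = (\<Sum>A\<in>Pow U. \<Sum>r\<in>S. \<Sum>s\<in>S. if A \<in> small s then g A r s else 0)"
      by (rule sum.cong[OF refl], rule sum.swap)
    finally show ?thesis .
  qed
  have "(\<Sum>s\<in>S. if A \<in> small s then h A r (rest r A \<circ> s) else 0) = (\<Sum>s\<in>S. if A \<in> small s then h A r s else 0)"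
    if A: "A \<in> Pow U" and r: "r \<in> S" for A r
  proof -
    have k: "rest r A \<in> S" "\<And>a. a \<in> A \<Longrightarrow> rest r A a = a" using rest(1,2)[OF r] A by auto
    have "(\<Sum>s\<in>S. if A \<in> small s then h A r (rest r A \<circ> s) else 0)
        = (\<Sum>s\<in>S. if A \<in> small (rest r A \<circ> s) then h A r (rest r A \<circ> s) else 0)"
      using small_comp_fixing_iff[OF _ k] by (intro sum.cong refl) simp
    also have "\<dots> = (\<Sum>s\<in>S. if A \<in> small s then h A r s else 0)"
      by (rule sum_comp_left[OF k(1), of "\<lambda>s. if A \<in> small s then h A r s else 0"])
    finally show ?thesis .
  qed
  then show ?thesis unfolding flat by (rule sum.cong[OF refl sum.cong[OF refl]])
qed

lemma card_Union_small_le: "s \<in> S \<Longrightarrow> T \<subseteq> small s \<Longrightarrow> card (\<Union>T) \<le> K * card T"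
proof -
  assume s: "s \<in> S" and T: "T \<subseteq> small s"
  have "card (\<Union>T) \<le> (\<Sum>X\<in>T. card X)" by (rule card_Union_le_sum_card)
  also have "\<dots> \<le> (\<Sum>X\<in>T. K)" using smallD(5)[OF s] T by (intro sum_mono) auto
  finally show ?thesis by (simp add: mult.commute)
qed

text \<open>A union bound over the ways in which \<open>small_switch\<close> can fail: a small orbit
  of \<open>r \<circ> s\<close> meets \<open>A\<close>, or the image of \<open>A\<close> under
  \<open>r\<close>, or a further small orbit of \<open>rest r A \<circ> s\<close> meets that image.
  The second sum is indexed by preimages under \<open>s\<close> so that \<open>r\<close> enters only
  through \<open>r \<circ> s\<close>. If none occurs, the two powers are equal.\<close>

lemma switch_error:
  fixes u :: real
  assumes s: "s \<in> S" and A: "A \<in> small s" and r: "r \<in> S" and u: "0 \<le> u" "u \<le> 1"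
  shows "\<bar>u ^ (N (rest r A \<circ> s) - 1) - u ^ N (r \<circ> s)\<bar> \<le>
    (\<Sum>x\<in>A. of_bool (x \<in> \<Union>(small (r \<circ> s)))) +
    (\<Sum>x\<in>inv s ` A. of_bool ((r \<circ> s) x \<in> \<Union>(small (r \<circ> s)))) +
    (\<Sum>x\<in>r ` A. of_bool (x \<in> \<Union>(small (rest r A \<circ> s) - {A})))"
    (is "_ \<le> ?e1 + ?e2 + ?e3")
proof -
  have AU: "A \<subseteq> U" using smallD(2)[OF s A] .
  have finA: "finite A" using smallD(4)[OF s A] .
  have nonneg: "0 \<le> ?e1" "0 \<le> ?e2" "0 \<le> ?e3" by (auto intro!: sum_nonneg)
  have pos: "1 \<le> (\<Sum>x\<in>B. of_bool (P x) :: real)" if "finite B" "x \<in> B" "P x" for B :: "nat set" and P x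
    using that member_le_sum[of x B "\<lambda>x. of_bool (P x) :: real"] by auto
  have le1: "\<bar>u ^ (N (rest r A \<circ> s) - 1) - u ^ N (r \<circ> s)\<bar> \<le> 1"
    using u by (rule abs_power_diff_le_1)
  consider (1) x where "x \<in> A" "x \<in> \<Union>(small (r \<circ> s))"
    | (2) x where "x \<in> A" "r x \<in> \<Union>(small (r \<circ> s))"
    | (3) x where "x \<in> r ` A" "x \<in> \<Union>(small (rest r A \<circ> s) - {A})"
    | (4) "\<And>X. X \<in> small (r \<circ> s) \<Longrightarrow> X \<inter> (A \<union> r ` A) = {}"
          "\<And>X. X \<in> small (rest r A \<circ> s) - {A} \<Longrightarrow> X \<inter> r ` A = {}"
    by blast
  then show ?thesis
  proof cases
    case 1
    then have "1 \<le> ?e1" using pos[OF finA, of x "\<lambda>x. x \<in> \<Union>(small (r \<circ> s))"] by simp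
    then show ?thesis using nonneg le1 by linarith
  next
    case 2
    have "(r \<circ> s) (inv s x) = r x" using S_inv[OF s] by simp
    then have "1 \<le> ?e2"
      using pos[of "inv s ` A" "inv s x" "\<lambda>x. (r \<circ> s) x \<in> \<Union>(small (r \<circ> s))"] 2 finA by simp
    then show ?thesis using nonneg le1 by linarith
  next
    case 3
    then have "1 \<le> ?e3"
      using pos[of "r ` A" x "\<lambda>x. x \<in> \<Union>(small (rest r A \<circ> s) - {A})"] finA by simp
    then show ?thesis using nonneg le1 by linarith
  next
    case 4
    have "small (r \<circ> s) = small (rest r A \<circ> s) - {A}"
      using rest[OF r AU] by (intro small_switch[OF s r _ A _ _ 4]) auto
    moreover have "A \<in> small (rest r A \<circ> s)"
      using rest[OF r AU] by (intro small_comp_fixing[OF s _ A])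
    ultimately have "N (rest r A \<circ> s) - 1 = N (r \<circ> s)"
      using finite_small by (simp add: N_def)
    then show ?thesis using nonneg by simp
  qed
qed

lemma sum_apply_mem_le:
  assumes "finite A" "finite B" "A \<subseteq> U" "B \<subseteq> U"
  shows "(\<Sum>r\<in>S. \<Sum>x\<in>r ` A. of_bool (x \<in> B)) \<le> real (card A) * real (card B) * (fact (card U) / real (card U))"
proof -
  have "(\<Sum>x\<in>r ` A. of_bool (x \<in> B)) = (\<Sum>a\<in>A. \<Sum>b\<in>B. of_bool (r a = b) :: real)" if "r \<in> S" for r
  proof -
    have "inj_on r A" using that permutes_inj_on unfolding S_iff by blast
    then have "(\<Sum>x\<in>r ` A. of_bool (x \<in> B)) = (\<Sum>a\<in>A. of_bool (r a \<in> B) :: real)"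
      by (simp add: sum.reindex)
    also have "\<dots> = (\<Sum>a\<in>A. \<Sum>b\<in>B. of_bool (r a = b))"
      using assms(2) by (intro sum.cong refl) (simp add: of_bool_def sum.delta)
    finally show ?thesis .
  qed
  then have "(\<Sum>r\<in>S. \<Sum>x\<in>r ` A. of_bool (x \<in> B)) = (\<Sum>r\<in>S. \<Sum>a\<in>A. \<Sum>b\<in>B. of_bool (r a = b) :: real)"
    by (rule sum.cong[OF refl])
  also have "\<dots> = (\<Sum>a\<in>A. \<Sum>b\<in>B. \<Sum>r\<in>S. of_bool (r a = b))"
    by (subst sum.swap) (intro sum.cong refl sum.swap)
  also have "\<dots> = (\<Sum>a\<in>A. \<Sum>b\<in>B. fact (card U) / real (card U))"
  proof (intro sum.cong refl)
    fix a b assume "a \<in> A" "b \<in> B"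
    then have "a \<in> U" "b \<in> U" using assms by auto
    then have "real (card {s. s permutes U \<and> s a = b}) = fact (card U) / real (card U)"
      by (rule card_permutes_apply_eq[OF finU])
    moreover have "(\<Sum>r\<in>S. of_bool (r a = b) :: real) = real (card {s. s permutes U \<and> s a = b})"
      using finS by (simp add: of_bool_def sum.If_cases Int_def S_iff)
    ultimately show "(\<Sum>r\<in>S. of_bool (r a = b)) = fact (card U) / real (card U)" by simp
  qed
  finally show ?thesis by simp
qed

text \<open>After division by \<open>fact (card U) ^ 2\<close> the left side is the distance between
  the mean of \<open>N * u ^ (N - 1)\<close> and the product of the means of \<open>N\<close> and
  \<open>u ^ N\<close>. Writing \<open>N\<close> as a sum over small orbits \<open>A\<close>, the
  first quantity uses \<open>rest r A \<circ> s\<close> and the second \<open>r \<circ> s\<close>,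
  which is uniform for every \<open>s\<close>. Their difference is summed by
  \<open>switch_error\<close>; \<open>b\<close> bounds the chance that a given point lies in a small
  orbit.\<close>

lemma size_bias_bound:
  fixes u b :: real
  assumes u: "0 \<le> u" "u \<le> 1" and b: "0 \<le> b"
    and b1: "\<And>x. x \<in> U \<Longrightarrow> (\<Sum>s\<in>S. of_bool (x \<in> \<Union>(small s))) \<le> fact (card U) * b"
    and b2: "\<And>x. x \<in> U \<Longrightarrow> (\<Sum>s\<in>S. of_bool (s x \<in> \<Union>(small s))) \<le> fact (card U) * b"
  shows "\<bar>fact (card U) * (\<Sum>s\<in>S. real (N s) * u ^ (N s - 1)) - (\<Sum>s\<in>S. real (N s)) * (\<Sum>s\<in>S. u ^ N s)\<bar>
    \<le> fact (card U) * (2 * real K * b * (\<Sum>s\<in>S. real (N s))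
        + real K ^ 2 / real (card U) * (\<Sum>s\<in>S. real (N s) * real (N s - 1)))"
proof -
  let ?f = "fact (card U) :: real"
  let ?e1 = "\<lambda>s A r. \<Sum>x\<in>A. of_bool (x \<in> \<Union>(small (r \<circ> s))) :: real"
  let ?e2 = "\<lambda>s A r. \<Sum>x\<in>inv s ` A. of_bool ((r \<circ> s) x \<in> \<Union>(small (r \<circ> s))) :: real"
  let ?e3 = "\<lambda>A r s. \<Sum>x\<in>r ` A. of_bool (x \<in> \<Union>(small s - {A})) :: real"
  have e1: "(\<Sum>r\<in>S. ?e1 s A r) \<le> real K * (?f * b)" if s: "s \<in> S" and A: "A \<in> small s" for s A
  proof -
    have "(\<Sum>r\<in>S. ?e1 s A r) = (\<Sum>x\<in>A. \<Sum>r\<in>S. of_bool (x \<in> \<Union>(small (r \<circ> s))))"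
      by (rule sum.swap)
    also have "\<dots> = (\<Sum>x\<in>A. \<Sum>r\<in>S. of_bool (x \<in> \<Union>(small r)))"
      by (intro sum.cong refl sum_comp_right[OF s, where g = "\<lambda>r. of_bool (_ \<in> \<Union>(small r))"])
    also have "\<dots> \<le> (\<Sum>x\<in>A. ?f * b)"
      using b1 smallD(2)[OF s A] by (intro sum_mono) auto
    also have "\<dots> \<le> real K * (?f * b)"
      using smallD(5)[OF s A] b by (simp add: mult_right_mono)
    finally show ?thesis .
  qed
  have e2: "(\<Sum>r\<in>S. ?e2 s A r) \<le> real K * (?f * b)" if s: "s \<in> S" and A: "A \<in> small s" for s A
  proof -
    have "inv s ` A \<subseteq> U"
      using smallD(2)[OF s A] permutes_in_image[of "inv s" U] inv_S[OF s] by (auto simp: S_iff)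
    moreover have "card (inv s ` A) \<le> K"
      using card_image_le[OF smallD(4)[OF s A], of "inv s"] smallD(5)[OF s A] by linarith
    ultimately have *: "(\<Sum>x\<in>inv s ` A. ?f * b) \<le> real K * (?f * b)"
      using b by (simp add: mult_right_mono)
    have "(\<Sum>r\<in>S. ?e2 s A r) = (\<Sum>x\<in>inv s ` A. \<Sum>r\<in>S. of_bool ((r \<circ> s) x \<in> \<Union>(small (r \<circ> s))))"
      by (rule sum.swap)
    also have "\<dots> = (\<Sum>x\<in>inv s ` A. \<Sum>r\<in>S. of_bool (r x \<in> \<Union>(small r)))"
      by (intro sum.cong refl sum_comp_right[OF s, where g = "\<lambda>r. of_bool (r _ \<in> \<Union>(small r))"])
    also have "\<dots> \<le> (\<Sum>x\<in>inv s ` A. ?f * b)"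
      using b2 \<open>inv s ` A \<subseteq> U\<close> by (intro sum_mono) auto
    finally show ?thesis using * by linarith
  qed
  \<comment> \<open>Here \<open>sum_small_rest\<close> has already replaced
    \<open>rest r A \<circ> s\<close> by \<open>s\<close>, so \<open>r\<close> is independent of the
    set to be hit. That set has at most \<open>K * (N s - 1)\<close> points, and each of at most
    \<open>K\<close> points of \<open>A\<close> is sent to a given one with probability
    \<open>1 / card U\<close>.\<close>
  have e3: "(\<Sum>r\<in>S. ?e3 A r s) \<le> ?f * (real K ^ 2 / real (card U) * real (N s - 1))"
    if s: "s \<in> S" and A: "A \<in> small s" for s A
  proof -
    let ?B = "\<Union>(small s - {A})"
    have B: "finite ?B" "?B \<subseteq> U"
      using small_subset_Pow[OF s] smallD(4)[OF s] finite_small by auto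
    have "card ?B \<le> K * (N s - 1)"
      using card_Union_small_le[OF s, of "small s - {A}"] A finite_small by (simp add: N_def)
    then have "real (card ?B) \<le> real K * real (N s - 1)" by (metis of_nat_le_iff of_nat_mult)
    then have "real (card A) * real (card ?B) \<le> real K * (real K * real (N s - 1))"
      using smallD(5)[OF s A] by (intro mult_mono) auto
    then have "real (card A) * real (card ?B) * (?f / real (card U))
        \<le> real K * (real K * real (N s - 1)) * (?f / real (card U))"
      by (rule mult_right_mono) simp
    then show ?thesis
      using sum_apply_mem_le[OF smallD(4)[OF s A] B(1) smallD(2)[OF s A] B(2)]
      by (simp add: power2_eq_square algebra_simps)
  qed
  have L: "?f * (\<Sum>s\<in>S. real (N s) * u ^ (N s - 1))
      = (\<Sum>s\<in>S. \<Sum>A\<in>small s. \<Sum>r\<in>S. u ^ (N (rest r A \<circ> s) - 1))"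
    unfolding sum_small_rest[of "\<lambda>A r s. u ^ (N s - 1)"]
    by (simp add: cardS N_def[symmetric] sum_distrib_left mult_ac)
  have R: "(\<Sum>s\<in>S. real (N s)) * (\<Sum>s\<in>S. u ^ N s) = (\<Sum>s\<in>S. \<Sum>A\<in>small s. \<Sum>r\<in>S. u ^ N (r \<circ> s))"
  proof -
    have "(\<Sum>s\<in>S. \<Sum>A\<in>small s. \<Sum>r\<in>S. u ^ N (r \<circ> s)) = (\<Sum>s\<in>S. \<Sum>A\<in>small s. \<Sum>r\<in>S. u ^ N r)"
      by (intro sum.cong refl sum_comp_right[where g = "\<lambda>r. u ^ N r"])
    then show ?thesis by (simp add: N_def[symmetric] sum_distrib_right)
  qed
  have "\<bar>?f * (\<Sum>s\<in>S. real (N s) * u ^ (N s - 1)) - (\<Sum>s\<in>S. real (N s)) * (\<Sum>s\<in>S. u ^ N s)\<bar>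
      = \<bar>\<Sum>s\<in>S. \<Sum>A\<in>small s. \<Sum>r\<in>S. u ^ (N (rest r A \<circ> s) - 1) - u ^ N (r \<circ> s)\<bar>"
    unfolding L R by (simp add: sum_subtractf)
  also have "\<dots> \<le> (\<Sum>s\<in>S. \<Sum>A\<in>small s. \<Sum>r\<in>S. \<bar>u ^ (N (rest r A \<circ> s) - 1) - u ^ N (r \<circ> s)\<bar>)"
    by (intro order_trans[OF sum_abs] sum_mono order_refl)
  also have "\<dots> \<le> (\<Sum>s\<in>S. \<Sum>A\<in>small s. \<Sum>r\<in>S. ?e1 s A r + ?e2 s A r + ?e3 A r (rest r A \<circ> s))"
    by (intro sum_mono switch_error u)
  also have "\<dots> = (\<Sum>s\<in>S. \<Sum>A\<in>small s. (\<Sum>r\<in>S. ?e1 s A r) + (\<Sum>r\<in>S. ?e2 s A r))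
      + (\<Sum>s\<in>S. \<Sum>A\<in>small s. \<Sum>r\<in>S. ?e3 A r (rest r A \<circ> s))"
    by (simp add: sum.distrib)
  also have "(\<Sum>s\<in>S. \<Sum>A\<in>small s. \<Sum>r\<in>S. ?e3 A r (rest r A \<circ> s)) = (\<Sum>s\<in>S. \<Sum>A\<in>small s. \<Sum>r\<in>S. ?e3 A r s)"
    by (rule sum_small_rest)
  also have "(\<Sum>s\<in>S. \<Sum>A\<in>small s. (\<Sum>r\<in>S. ?e1 s A r) + (\<Sum>r\<in>S. ?e2 s A r)) + (\<Sum>s\<in>S. \<Sum>A\<in>small s. \<Sum>r\<in>S. ?e3 A r s)
      \<le> (\<Sum>s\<in>S. \<Sum>A\<in>small s. real K * (?f * b) + real K * (?f * b))
        + (\<Sum>s\<in>S. \<Sum>A\<in>small s. ?f * (real K ^ 2 / real (card U) * real (N s - 1)))"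
    by (intro add_mono sum_mono e1 e2 e3)
  also have "\<dots> = ?f * (2 * real K * b * (\<Sum>s\<in>S. real (N s))
        + real K ^ 2 / real (card U) * (\<Sum>s\<in>S. real (N s) * real (N s - 1)))"
    by (simp add: N_def[symmetric] sum_distrib_left sum_distrib_right sum.distrib algebra_simps)
  finally show ?thesis .
qed

end

section \<open>Poisson approximation\<close>

text \<open>The mean value theorem for \<open>F u = exp (- l * u) * G u\<close> on the unit
  interval. Its derivative is \<open>exp (- l * u) * (G' u - l * G u)\<close>, where the exponential
  is at most 1 because \<open>l\<close> is nonnegative.\<close>

lemma poisson_interpolation:
  fixes N :: "'a \<Rightarrow> nat" and c l D :: real
  assumes fin: "finite S" and c: "c = real (card S)" "c > 0" and lam: "l = (\<Sum>s\<in>S. real (N s)) / c"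
    and D: "\<And>u. 0 \<le> u \<Longrightarrow> u \<le> 1 \<Longrightarrow>
      \<bar>(\<Sum>s\<in>S. real (N s) * u ^ (N s - 1)) / c - l * ((\<Sum>s\<in>S. u ^ N s) / c)\<bar> \<le> D"
  shows "\<bar>real (card {s \<in> S. N s = 0}) / c - exp (- l)\<bar> \<le> D"
proof -
  define G where "G u = (\<Sum>s\<in>S. u ^ N s) / c" for u :: real
  define G' where "G' u = (\<Sum>s\<in>S. real (N s) * u ^ (N s - 1)) / c" for u :: real
  define F where "F u = exp (- l * u) * G u" for u :: real
  have lam0: "0 \<le> l" using lam c by (simp add: sum_nonneg)
  have G: "(G has_real_derivative G' u) (at u)" for u
    unfolding G_def G'_def using c(2) by (auto intro!: derivative_eq_intros sum.cong simp: mult_ac)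
  have F: "(F has_real_derivative exp (- l * u) * (G' u - l * G u)) (at u)" for u
    unfolding F_def by (auto intro!: derivative_eq_intros G simp: algebra_simps)
  have "\<exists>z::real. 0 < z \<and> z < 1 \<and> F 1 - F 0 = (1 - 0) * (exp (- l * z) * (G' z - l * G z))"
    by (rule MVT2) (use F in auto)
  then obtain z where z: "0 < z" "z < 1" "F 1 - F 0 = exp (- l * z) * (G' z - l * G z)" by auto
  have "\<bar>G' z - l * G z\<bar> \<le> D" unfolding G_def G'_def using D[of z] z by simp
  moreover have "exp (- l * z) \<le> 1" using lam0 z by simp
  ultimately have "\<bar>F 1 - F 0\<bar> \<le> 1 * D"
    unfolding z(3) abs_mult by (intro mult_mono) auto
  moreover have "F 1 = exp (- l)" using c by (simp add: F_def G_def)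
  \<comment> \<open>The convention \<open>0 ^ 0 = 1\<close> makes the power at zero the indicator of
    \<open>N s = 0\<close>.\<close>
  moreover have "F 0 = real (card {s \<in> S. N s = 0}) / c"
    using fin by (simp add: F_def G_def power_0_left sum.If_cases Int_def)
  ultimately show ?thesis by linarith
qed

lemma exp_neg_diff_le:
  fixes a b :: real
  assumes "0 \<le> a" "a \<le> b"
  shows "\<bar>exp (- a) - exp (- b)\<bar> \<le> b - a"
proof -
  have "exp (- a) - exp (- b) = exp (- a) * (1 - exp (- (b - a)))"
    by (simp add: right_diff_distrib exp_add[symmetric])
  also have "\<dots> \<le> 1 * (b - a)"
  proof (rule mult_mono)
    show "1 - exp (- (b - a)) \<le> b - a" using exp_ge_add_one_self[of "- (b - a)"] by linarith
  qed (use assms in auto)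
  finally show ?thesis using assms by simp
qed

definition inv_sets :: "'a set \<Rightarrow> ('a \<Rightarrow> 'a) \<Rightarrow> nat \<Rightarrow> 'a set set" where
  "inv_sets U p k = {Z. Z \<subseteq> U \<and> invariant {p} Z \<and> card Z = k}"

lemma finite_inv_sets: "finite U \<Longrightarrow> finite (inv_sets U p k)"
  unfolding inv_sets_def by (rule finite_subset[of _ "Pow U"]) auto

section \<open>Moments of small orbits through common invariant sets\<close>

context perm_pair
begin

text \<open>Invariance under \<open>cj s\<close> is expressed as invariance of the preimage under
  \<open>q\<close>. The count then concerns two fixed families of sets matched by a random
  \<open>s\<close>.\<close>

definition "common s k = {Z \<in> inv_sets U p k. inv s ` Z \<in> inv_sets U q k}"

text \<open>The expected number of common invariant \<open>k\<close>-sets, by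
  \<open>sum_card_common\<close>.\<close>

definition "M k = real (card (inv_sets U p k)) * real (card (inv_sets U q k)) / real (card U choose k)"

lemma M_nonneg: "0 \<le> M k"
  by (simp add: M_def)

lemma finite_common: "finite (common s k)"
  unfolding common_def using finite_inv_sets[OF finU] by simp

lemma commonI:
  assumes s: "s \<in> S" and Z: "Z \<subseteq> U" "invariant {p} Z" "invariant {cj s} Z"
  shows "Z \<in> common s (card Z)"
proof -
  have "invariant {q} (inv s ` Z)"
  proof -
    have "q (inv s z) \<in> inv s ` Z" if "z \<in> Z" for z
    proof -
      have "cj s z \<in> Z" using Z(3) that by (auto simp: invariant_def)
      moreover have "q (inv s z) = inv s (cj s z)" using S_inv[OF s] by (simp add: cj_def)
      ultimately show ?thesis by simp
    qed
    then show ?thesis by (auto simp: invariant_def)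
  qed
  moreover have i: "inv s permutes U" using inv_S[OF s] by (simp add: S_iff)
  have "inv s ` Z \<subseteq> U" using Z(1) permutes_in_image[OF i] by auto
  moreover have "card (inv s ` Z) = card Z"
    by (rule card_image) (use permutes_inj_on[OF i] in blast)
  ultimately show ?thesis using Z by (simp add: common_def inv_sets_def)
qed

lemma orbs_common: "s \<in> S \<Longrightarrow> X \<in> orbs s \<Longrightarrow> X \<in> common s (card X)"
  using commonI orbsD by metis

lemma card_orbs_pos:
  assumes "s \<in> S" "X \<in> orbs s" shows "1 \<le> card X"
  using orbsD(2,5)[OF assms] by (simp add: Suc_leI card_gt_0_iff)

lemma sum_card_common: "(\<Sum>s\<in>S. real (card (common s k))) = fact (card U) * M k"
  unfolding S_def common_def M_def
  by (rule sum_card_permutes_pairs[OF finU]) (auto simp: inv_sets_def)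

lemma card_orbs_range_le:
  assumes s: "s \<in> S" and I: "finite I"
  shows "card {X \<in> orbs s. card X \<in> I} \<le> (\<Sum>k\<in>I. card (common s k))"
proof -
  have "{X \<in> orbs s. card X \<in> I} \<subseteq> (\<Union>k\<in>I. common s k)"
    using orbs_common[OF s] by blast
  then have "card {X \<in> orbs s. card X \<in> I} \<le> card (\<Union>k\<in>I. common s k)"
    using I finite_common by (intro card_mono) auto
  also have "\<dots> \<le> (\<Sum>k\<in>I. card (common s k))" using I by (rule card_UN_le)
  finally show ?thesis .
qed

lemma small_eq_range: "s \<in> S \<Longrightarrow> small s = {X \<in> orbs s. card X \<in> {1..K}}"
  using card_orbs_pos unfolding small_def by auto

lemma sum_N_le: "(\<Sum>s\<in>S. real (N s)) \<le> fact (card U) * (\<Sum>k=1..K. M k)"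
proof -
  have "(\<Sum>s\<in>S. real (N s)) \<le> (\<Sum>s\<in>S. \<Sum>k=1..K. real (card (common s k)))"
  proof (rule sum_mono)
    fix s assume s: "s \<in> S"
    show "real (N s) \<le> (\<Sum>k=1..K. real (card (common s k)))"
      using card_orbs_range_le[OF s finite_atLeastAtMost, of 1 K] unfolding N_def small_eq_range[OF s]
      by (metis of_nat_le_iff of_nat_sum)
  qed
  also have "\<dots> = (\<Sum>k=1..K. fact (card U) * M k)"
    by (subst sum.swap) (simp add: sum_card_common)
  finally show ?thesis by (simp add: sum_distrib_left)
qed

text \<open>An ordered pair of distinct small orbits is recovered from its union and its first
  member. The union is a common invariant set of size at most \<open>2 * K\<close>, which has at
  most \<open>2 ^ (2 * K) = 4 ^ K\<close> subsets.\<close>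

lemma pairs_le:
  assumes s: "s \<in> S"
  shows "N s * (N s - 1) \<le> 4 ^ K * (\<Sum>k=1..2*K. card (common s k))"
proof -
  let ?P = "SIGMA A:small s. small s - {A}"
  let ?Q = "SIGMA Z:(\<Union>k\<in>{1..2*K}. common s k). Pow Z"
  have disj: "A \<inter> B = {}" if "(A, B) \<in> ?P" for A B
    using that small_disjoint[OF s] by auto
  have inj: "inj_on (\<lambda>(A, B). (A \<union> B, A)) ?P"
    by (rule inj_on_inverseI[where g = "\<lambda>(Z, A). (A, Z - A)"]) (use disj in force)
  have sub: "(\<lambda>(A, B). (A \<union> B, A)) ` ?P \<subseteq> ?Q"
  proof (rule image_subsetI)
    fix AB assume "AB \<in> ?P"
    then obtain A B where AB: "A \<in> small s" "B \<in> small s" "AB = (A, B)" by auto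
    note A = smallD[OF s AB(1)] and B = smallD[OF s AB(2)]
    have "invariant {p} (A \<union> B)" "invariant {cj s} (A \<union> B)"
      using orbsD(3,4)[OF s A(1)] orbsD(3,4)[OF s B(1)] by (auto simp: invariant_def)
    then have "A \<union> B \<in> common s (card (A \<union> B))" using commonI[OF s] A(2) B(2) by simp
    moreover have "card (A \<union> B) \<le> 2 * K" using card_Un_le[of A B] A(5) B(5) by linarith
    moreover have "card (A \<union> B) \<ge> 1" using A(3,4) B(4) by (simp add: Suc_leI card_gt_0_iff)
    ultimately show "(case AB of (A, B) \<Rightarrow> (A \<union> B, A)) \<in> ?Q"
      unfolding AB(3) by (auto intro!: bexI[of _ "card (A \<union> B)"])
  qed
  have finZ: "finite Z" if "Z \<in> common s k" for Z k
    using that finU finite_subset by (auto simp: common_def inv_sets_def)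
  have finQ: "finite ?Q" using finite_common finZ by (intro finite_SigmaI) auto
  have "N s * (N s - 1) = card ?P"
    using finite_small by (subst card_SigmaI) (auto simp: N_def)
  also have "\<dots> \<le> card ?Q"
    using card_inj_on_le[OF inj sub finQ] .
  also have "\<dots> = (\<Sum>Z\<in>(\<Union>k\<in>{1..2*K}. common s k). card (Pow Z))"
    using finite_common finZ by (intro card_SigmaI) auto
  also have "\<dots> \<le> (\<Sum>Z\<in>(\<Union>k\<in>{1..2*K}. common s k). 4 ^ K)"
  proof (rule sum_mono)
    fix Z assume "Z \<in> (\<Union>k\<in>{1..2*K}. common s k)"
    then obtain k where k: "k \<in> {1..2*K}" "Z \<in> common s k" by (elim UN_E)
    then have "card Z \<le> 2 * K" "finite Z"
      using finZ[OF k(2)] by (auto simp: common_def inv_sets_def)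
    then have "card (Pow Z) \<le> 2 ^ (2 * K)" by (simp add: card_Pow)
    then show "card (Pow Z) \<le> 4 ^ K" by (simp add: power_mult)
  qed
  also have "\<dots> = 4 ^ K * card (\<Union>k\<in>{1..2*K}. common s k)" by simp
  also have "\<dots> \<le> 4 ^ K * (\<Sum>k=1..2*K. card (common s k))"
    by (intro mult_left_mono card_UN_le) auto
  finally show ?thesis .
qed

lemma sum_pairs_le:
  "(\<Sum>s\<in>S. real (N s) * real (N s - 1)) \<le> fact (card U) * (4 ^ K * (\<Sum>k=1..2*K. M k))"
proof -
  have "(\<Sum>s\<in>S. real (N s) * real (N s - 1)) \<le> (\<Sum>s\<in>S. 4 ^ K * (\<Sum>k=1..2*K. real (card (common s k))))"
  proof (rule sum_mono)
    fix s assume "s \<in> S"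
    from pairs_le[OF this] have "real (N s * (N s - 1)) \<le> real (4 ^ K * (\<Sum>k=1..2*K. card (common s k)))"
      by (rule of_nat_mono)
    then show "real (N s) * real (N s - 1) \<le> 4 ^ K * (\<Sum>k=1..2*K. real (card (common s k)))" by simp
  qed
  also have "\<dots> = 4 ^ K * (\<Sum>k=1..2*K. \<Sum>s\<in>S. real (card (common s k)))"
    by (simp add: sum_distrib_left[symmetric] sum.swap[of _ S])
  finally show ?thesis by (simp add: sum_card_common sum_distrib_left mult_ac)
qed

text \<open>A small orbit through \<open>x\<close> is a common invariant set containing
  \<open>x\<close>, so the first moment, summed over sizes up to \<open>K\<close>, bounds the
  probability.\<close>

lemma hit_left:
  assumes \<beta>: "\<And>k. 1 \<le> k \<Longrightarrow> k \<le> K \<Longrightarrow>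
      real (card {Z \<in> inv_sets U p k. x \<in> Z}) * real (card (inv_sets U q k)) / real (card U choose k) \<le> \<beta>"
  shows "(\<Sum>s\<in>S. of_bool (x \<in> \<Union>(small s))) \<le> fact (card U) * (real K * \<beta>)"
proof -
  let ?P = "\<lambda>k. {Z \<in> inv_sets U p k. x \<in> Z}"
  let ?c = "\<lambda>s k. {Z \<in> ?P k. inv s ` Z \<in> inv_sets U q k}"
  have "(\<Sum>s\<in>S. of_bool (x \<in> \<Union>(small s))) \<le> (\<Sum>s\<in>S. \<Sum>k=1..K. real (card (?c s k)))"
  proof (rule sum_mono)
    fix s assume s: "s \<in> S"
    show "of_bool (x \<in> \<Union>(small s)) \<le> (\<Sum>k=1..K. real (card (?c s k)))"
    proof (cases "x \<in> \<Union>(small s)")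
      case True
      then obtain X where X: "X \<in> small s" "x \<in> X" by blast
      note XD = smallD[OF s X(1)]
      have "X \<in> ?c s (card X)" using orbs_common[OF s XD(1)] X(2) by (simp add: common_def)
      then have "?c s (card X) \<noteq> {}" by (rule ex_in_conv[THEN iffD1, OF exI])
      moreover have "finite (?c s (card X))" using finite_inv_sets[OF finU] by simp
      ultimately have "0 < card (?c s (card X))" unfolding card_gt_0_iff by (rule conjI)
      then have "1 \<le> real (card (?c s (card X)))" by linarith
      moreover have "real (card (?c s (card X))) \<le> (\<Sum>k=1..K. real (card (?c s k)))"
        using card_orbs_pos[OF s XD(1)] XD(5) by (intro member_le_sum) auto
      ultimately have "1 \<le> (\<Sum>k=1..K. real (card (?c s k)))" by (rule order_trans)
      then show ?thesis using True by simp
    qed (simp add: sum_nonneg)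
  qed
  also have "\<dots> = (\<Sum>k=1..K. \<Sum>s\<in>S. real (card (?c s k)))" by (rule sum.swap)
  also have "\<dots> \<le> (\<Sum>k=1..K. fact (card U) * \<beta>)"
  proof (rule sum_mono)
    fix k assume k: "k \<in> {1..K}"
    have "(\<Sum>s\<in>S. real (card (?c s k))) = fact (card U) *
        (real (card (?P k)) * real (card (inv_sets U q k)) / real (card U choose k))"
      unfolding S_def by (rule sum_card_permutes_pairs[OF finU]) (auto simp: inv_sets_def)
    also have "\<dots> \<le> fact (card U) * \<beta>" using \<beta>[of k] k by (intro mult_left_mono) auto
    finally show "(\<Sum>s\<in>S. real (card (?c s k))) \<le> fact (card U) * \<beta>" .
  qed
  finally show ?thesis by (simp add: mult.left_commute)
qed

text \<open>The mirror image of \<open>hit_left\<close>: an orbit contains \<open>s x\<close>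
  exactly when its preimage under \<open>s\<close>, an invariant set of \<open>q\<close>, contains
  \<open>x\<close>.\<close>

lemma hit_right:
  assumes \<beta>: "\<And>k. 1 \<le> k \<Longrightarrow> k \<le> K \<Longrightarrow>
      real (card (inv_sets U p k)) * real (card {Z \<in> inv_sets U q k. x \<in> Z}) / real (card U choose k) \<le> \<beta>"
  shows "(\<Sum>s\<in>S. of_bool (s x \<in> \<Union>(small s))) \<le> fact (card U) * (real K * \<beta>)"
proof -
  let ?Q = "\<lambda>k. {Z \<in> inv_sets U q k. x \<in> Z}"
  let ?c = "\<lambda>s k. {Z \<in> inv_sets U p k. inv s ` Z \<in> ?Q k}"
  have "(\<Sum>s\<in>S. of_bool (s x \<in> \<Union>(small s))) \<le> (\<Sum>s\<in>S. \<Sum>k=1..K. real (card (?c s k)))"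
  proof (rule sum_mono)
    fix s assume s: "s \<in> S"
    show "of_bool (s x \<in> \<Union>(small s)) \<le> (\<Sum>k=1..K. real (card (?c s k)))"
    proof (cases "s x \<in> \<Union>(small s)")
      case True
      then obtain X where X: "X \<in> small s" "s x \<in> X" by blast
      note XD = smallD[OF s X(1)]
      have "x \<in> inv s ` X" using X(2) S_inv(2)[OF s] by (metis image_eqI)
      then have "X \<in> ?c s (card X)" using orbs_common[OF s XD(1)] by (simp add: common_def)
      then have "?c s (card X) \<noteq> {}" by (rule ex_in_conv[THEN iffD1, OF exI])
      moreover have "finite (?c s (card X))" using finite_inv_sets[OF finU] by simp
      ultimately have "0 < card (?c s (card X))" unfolding card_gt_0_iff by (rule conjI)
      then have "1 \<le> real (card (?c s (card X)))" by linarith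
      moreover have "real (card (?c s (card X))) \<le> (\<Sum>k=1..K. real (card (?c s k)))"
        using card_orbs_pos[OF s XD(1)] XD(5) by (intro member_le_sum) auto
      ultimately have "1 \<le> (\<Sum>k=1..K. real (card (?c s k)))" by (rule order_trans)
      then show ?thesis using True by simp
    qed (simp add: sum_nonneg)
  qed
  also have "\<dots> = (\<Sum>k=1..K. \<Sum>s\<in>S. real (card (?c s k)))" by (rule sum.swap)
  also have "\<dots> \<le> (\<Sum>k=1..K. fact (card U) * \<beta>)"
  proof (rule sum_mono)
    fix k assume k: "k \<in> {1..K}"
    have "(\<Sum>s\<in>S. real (card (?c s k))) = fact (card U) *
        (real (card (inv_sets U p k)) * real (card (?Q k)) / real (card U choose k))"
      unfolding S_def by (rule sum_card_permutes_pairs[OF finU]) (auto simp: inv_sets_def)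
    also have "\<dots> \<le> fact (card U) * \<beta>" using \<beta>[of k] k by (intro mult_left_mono) auto
    finally show "(\<Sum>s\<in>S. real (card (?c s k))) \<le> fact (card U) * \<beta>" .
  qed
  finally show ?thesis by (simp add: mult.left_commute)
qed

text \<open>Supplies \<open>poisson_interpolation\<close> with \<open>size_bias_bound\<close>,
  taking \<open>b = K * \<beta>\<close>. The single quantity \<open>L\<close> controls the mean of
  \<open>N\<close> and, up to the factor \<open>4 ^ K\<close>, the mean number of ordered
  pairs.\<close>

lemma small_poisson:
  fixes \<beta> :: real
  assumes \<beta>0: "0 \<le> \<beta>"
    and \<beta>1: "\<And>k x. 1 \<le> k \<Longrightarrow> k \<le> K \<Longrightarrow> x \<in> U \<Longrightarrow>
      real (card {Z \<in> inv_sets U p k. x \<in> Z}) * real (card (inv_sets U q k)) / real (card U choose k) \<le> \<beta>"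
    and \<beta>2: "\<And>k x. 1 \<le> k \<Longrightarrow> k \<le> K \<Longrightarrow> x \<in> U \<Longrightarrow>
      real (card (inv_sets U p k)) * real (card {Z \<in> inv_sets U q k. x \<in> Z}) / real (card U choose k) \<le> \<beta>"
  defines "L \<equiv> \<Sum>k=1..2*K. M k"
  shows "\<bar>real (card {s \<in> S. N s = 0}) / fact (card U) - exp (- ((\<Sum>s\<in>S. real (N s)) / fact (card U)))\<bar>
    \<le> (2 * real K ^ 2 * \<beta> + real K ^ 2 * 4 ^ K / real (card U)) * L"
proof (rule poisson_interpolation[OF finS _ _ refl])
  let ?f = "fact (card U) :: real"
  show "?f = real (card S)" by (simp add: cardS)
  show "0 < ?f" by simp
  fix u :: real assume u: "0 \<le> u" "u \<le> 1"
  let ?a = "\<Sum>s\<in>S. real (N s) * u ^ (N s - 1)" and ?b = "\<Sum>s\<in>S. real (N s)" and ?c = "\<Sum>s\<in>S. u ^ N s"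
  let ?R = "2 * real K * (real K * \<beta>) * ?b + real K ^ 2 / real (card U) * (\<Sum>s\<in>S. real (N s) * real (N s - 1))"
  have "(\<Sum>k=1..K. M k) \<le> L"
    unfolding L_def by (intro sum_mono2) (auto simp: M_nonneg)
  then have "?b \<le> ?f * L" using sum_N_le by (meson fact_ge_zero mult_left_mono order_trans)
  moreover have "(\<Sum>s\<in>S. real (N s) * real (N s - 1)) \<le> ?f * (4 ^ K * L)"
    using sum_pairs_le unfolding L_def .
  ultimately have "?R \<le> 2 * real K * (real K * \<beta>) * (?f * L) + real K ^ 2 / real (card U) * (?f * (4 ^ K * L))"
    using \<beta>0 by (intro add_mono mult_left_mono) auto
  also have "\<dots> = ?f * ((2 * real K ^ 2 * \<beta> + real K ^ 2 * 4 ^ K / real (card U)) * L)"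
    by (simp add: power2_eq_square algebra_simps)
  finally have R: "?R \<le> ?f * ((2 * real K ^ 2 * \<beta> + real K ^ 2 * 4 ^ K / real (card U)) * L)" .
  have "\<bar>?f * ?a - ?b * ?c\<bar> \<le> ?f * ?R"
    using \<beta>0 hit_left[OF \<beta>1] hit_right[OF \<beta>2] by (intro size_bias_bound u) auto
  then have "\<bar>?f * ?a - ?b * ?c\<bar> / (?f * ?f) \<le> ?R / ?f"
    by (simp add: field_simps)
  also have "\<dots> \<le> (2 * real K ^ 2 * \<beta> + real K ^ 2 * 4 ^ K / real (card U)) * L"
    using R by (simp add: field_simps)
  also have "\<bar>?f * ?a - ?b * ?c\<bar> / (?f * ?f) = \<bar>(?f * ?a - ?b * ?c) / (?f * ?f)\<bar>"
    by (simp add: abs_mult)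
  also have "(?f * ?a - ?b * ?c) / (?f * ?f) = ?a / ?f - ?b / ?f * (?c / ?f)"
    by (simp add: diff_divide_distrib)
  finally show "\<bar>?a / ?f - ?b / ?f * (?c / ?f)\<bar> \<le>
      (2 * real K ^ 2 * \<beta> + real K ^ 2 * 4 ^ K / real (card U)) * L" .
qed

text \<open>Admitting orbits of sizes between \<open>K\<close> and \<open>m\<close> raises the mean
  by at most \<open>T\<close>, and by Markov's inequality lowers the probability of having no orbit
  by at most \<open>T\<close>. This accounts for the summand \<open>2 * T\<close>.\<close>

lemma truncated_poisson:
  fixes \<beta> :: real
  assumes K: "real K \<le> m" and \<beta>0: "0 \<le> \<beta>"
    and \<beta>1: "\<And>k x. 1 \<le> k \<Longrightarrow> k \<le> K \<Longrightarrow> x \<in> U \<Longrightarrow>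
      real (card {Z \<in> inv_sets U p k. x \<in> Z}) * real (card (inv_sets U q k)) / real (card U choose k) \<le> \<beta>"
    and \<beta>2: "\<And>k x. 1 \<le> k \<Longrightarrow> k \<le> K \<Longrightarrow> x \<in> U \<Longrightarrow>
      real (card (inv_sets U p k)) * real (card {Z \<in> inv_sets U q k. x \<in> Z}) / real (card U choose k) \<le> \<beta>"
  defines "L \<equiv> \<Sum>k=1..2*K. M k" and "T \<equiv> \<Sum>k | K < k \<and> real k \<le> m. M k"
    and "N' \<equiv> \<lambda>s. card {X \<in> orbs s. real (card X) \<le> m}"
  shows "\<bar>real (card {s \<in> S. N' s = 0}) / fact (card U) - exp (- ((\<Sum>s\<in>S. real (N' s)) / fact (card U)))\<bar>
    \<le> (2 * real K ^ 2 * \<beta> + real K ^ 2 * 4 ^ K / real (card U)) * L + 2 * T"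
proof -
  let ?f = "fact (card U) :: real"
  let ?I = "{k. K < k \<and> real k \<le> m}"
  have "?I \<subseteq> {..nat \<lfloor>m\<rfloor>}" by (auto simp: le_nat_floor)
  then have finI: "finite ?I" using finite_subset by blast
  have split: "N' s = N s + card {X \<in> orbs s. card X \<in> ?I}" for s
  proof -
    have "{X \<in> orbs s. real (card X) \<le> m} = small s \<union> {X \<in> orbs s. card X \<in> ?I}"
      using K by (force simp: small_def)
    moreover have "small s \<inter> {X \<in> orbs s. card X \<in> ?I} = {}" by (auto simp: small_def)
    ultimately show ?thesis
      unfolding N'_def N_def using finite_orbs finite_small by (simp add: card_Un_disjoint)
  qed
  have "(\<Sum>s\<in>S. real (card {X \<in> orbs s. card X \<in> ?I})) \<le> (\<Sum>s\<in>S. \<Sum>k\<in>?I. real (card (common s k)))"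
  proof (rule sum_mono)
    fix s assume "s \<in> S"
    from of_nat_mono[OF card_orbs_range_le[OF this finI], where 'a = real]
    show "real (card {X \<in> orbs s. card X \<in> ?I}) \<le> (\<Sum>k\<in>?I. real (card (common s k)))"
      unfolding of_nat_sum .
  qed
  also have "\<dots> = ?f * T"
    unfolding T_def by (subst sum.swap) (simp add: sum_card_common sum_distrib_left)
  finally have T: "(\<Sum>s\<in>S. real (card {X \<in> orbs s. card X \<in> ?I})) \<le> ?f * T" .
  define EN where "EN = (\<Sum>s\<in>S. real (N s)) / ?f"
  define EN' where "EN' = (\<Sum>s\<in>S. real (N' s)) / ?f"
  have "(\<Sum>s\<in>S. real (N' s)) = (\<Sum>s\<in>S. real (N s)) + (\<Sum>s\<in>S. real (card {X \<in> orbs s. card X \<in> ?I}))"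
    by (simp add: split sum.distrib)
  then have d1: "EN \<le> EN'" "EN' - EN \<le> T"
    using T by (simp_all add: EN_def EN'_def field_simps sum_nonneg)
  have "0 \<le> EN" by (simp add: EN_def sum_nonneg)
  with d1 have d2: "\<bar>exp (- EN) - exp (- EN')\<bar> \<le> T" using exp_neg_diff_le[of EN EN'] by linarith
  have "real (card {s \<in> S. N s = 0}) = (\<Sum>s\<in>S. of_bool (N s = 0))"
       "real (card {s \<in> S. N' s = 0}) = (\<Sum>s\<in>S. of_bool (N' s = 0))"
    using finS by (simp_all add: of_bool_def sum.If_cases Int_def)
  then have "real (card {s \<in> S. N s = 0}) - real (card {s \<in> S. N' s = 0})
      = (\<Sum>s\<in>S. of_bool (N s = 0) - of_bool (N' s = 0))"
    by (simp add: sum_subtractf)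
  also have "\<dots> \<le> (\<Sum>s\<in>S. real (card {X \<in> orbs s. card X \<in> ?I}))"
    by (intro sum_mono) (simp add: split)
  finally have d3: "real (card {s \<in> S. N s = 0}) - real (card {s \<in> S. N' s = 0}) \<le> ?f * T"
    using T by linarith
  have d4: "card {s \<in> S. N' s = 0} \<le> card {s \<in> S. N s = 0}"
    using finS by (intro card_mono) (auto simp: split)
  have d5: "\<bar>real (card {s \<in> S. N s = 0}) / ?f - real (card {s \<in> S. N' s = 0}) / ?f\<bar> \<le> T"
    using d3 d4 by (simp add: diff_divide_distrib[symmetric] abs_le_iff divide_le_eq mult.commute)
  have "\<bar>real (card {s \<in> S. N s = 0}) / ?f - exp (- EN)\<bar>
      \<le> (2 * real K ^ 2 * \<beta> + real K ^ 2 * 4 ^ K / real (card U)) * L"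
    unfolding EN_def L_def by (rule small_poisson[OF \<beta>0 \<beta>1 \<beta>2])
  then show ?thesis using d2 d5 unfolding EN'_def by linarith
qed

end

section \<open>Generating functions of invariant sets\<close>

text \<open>Dividing by \<open>(1 + t) powr r\<close> leaves two weights in the unit interval that
  sum to 1, each raised to a power at least 1.\<close>

lemma one_add_powr_le:
  fixes t r :: real
  assumes "0 \<le> t" "1 \<le> r"
  shows "1 + t powr r \<le> (1 + t) powr r"
proof -
  have "(t / (1 + t)) powr r \<le> (t / (1 + t)) powr 1"
    using assms by (intro powr_mono') (auto simp: field_simps)
  moreover have "(1 / (1 + t)) powr r \<le> (1 / (1 + t)) powr 1"
    using assms by (intro powr_mono') (auto simp: field_simps)
  ultimately have "(t / (1 + t)) powr r + (1 / (1 + t)) powr r \<le> t / (1 + t) + 1 / (1 + t)"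
    using assms by simp
  also have "\<dots> = 1" using assms by (simp add: field_simps)
  finally show ?thesis using assms by (simp add: powr_divide field_simps)
qed

text \<open>A cycle of length \<open>j\<close> contributes no more than \<open>j / 3\<close> cycles
  of length 3 would.\<close>

lemma one_add_power_le_cube:
  fixes y :: real
  assumes "0 < y" "3 \<le> j"
  shows "1 + y ^ j \<le> (1 + y ^ 3) powr (real j / 3)"
proof -
  have "(y ^ 3) powr (real j / 3) = y powr real j"
    using assms by (simp add: powr_powr powr_numeral[symmetric] del: powr_numeral)
  then show ?thesis
    using one_add_powr_le[of "y ^ 3" "real j / 3"] assms by (simp add: powr_realpow)
qed

text \<open>The product over the cycles, with all cycles of length at least 3 replaced by the same
  mass of 3-cycles.\<close>

definition gf_bound :: "nat \<Rightarrow> nat \<Rightarrow> nat \<Rightarrow> real \<Rightarrow> real" where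
  "gf_bound n a d y = (1 + y) ^ a * (1 + y\<^sup>2) ^ d * (1 + y ^ 3) powr ((real n - real a - 2 * real d) / 3)"

lemma orbit_prod_le:
  fixes y :: real and U :: "nat set"
  assumes U: "finite U" and p: "p permutes U" and y: "0 < y"
  defines "a \<equiv> card {X \<in> gen_orbits {p} U. card X = 1}"
    and "d \<equiv> card {X \<in> gen_orbits {p} U. card X = 2}"
  shows "(\<Prod>X\<in>gen_orbits {p} U. 1 + y ^ card X) \<le> gf_bound (card U) a d y" "a + 2 * d \<le> card U"
proof -
  let ?G = "gen_orbits {p} U"
  let ?G1 = "{X \<in> ?G. card X = 1}" and ?G2 = "{X \<in> ?G. card X = 2}" and ?G3 = "{X \<in> ?G. 3 \<le> card X}"
  have pp: "\<forall>f\<in>{p}. f permutes U" using p by simp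
  have fin: "finite ?G" using U by (rule finite_gen_orbits)
  have "1 \<le> card X" if "X \<in> ?G" for X
    using gen_orbits_subset(2,4)[OF U pp that] by (simp add: Suc_leI card_gt_0_iff)
  then have G: "?G = ?G1 \<union> (?G2 \<union> ?G3)" by force
  have "card U = (\<Sum>X\<in>?G. card X)" using sum_card_gen_orbits[OF U pp] by simp
  also have "\<dots> = (\<Sum>X\<in>?G1. card X) + ((\<Sum>X\<in>?G2. card X) + (\<Sum>X\<in>?G3. card X))"
    using fin by (subst G, subst sum.union_disjoint, simp, simp, force, subst sum.union_disjoint) auto
  finally have n: "card U = a + 2 * d + (\<Sum>X\<in>?G3. card X)" by (simp add: a_def d_def)
  then show "a + 2 * d \<le> card U" by simp
  have "(\<Prod>X\<in>?G3. 1 + y ^ card X) \<le> (\<Prod>X\<in>?G3. (1 + y ^ 3) powr (real (card X) / 3))"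
    using y one_add_power_le_cube[OF y] by (intro prod_mono) (auto intro!: add_nonneg_nonneg)
  also have "\<dots> = (1 + y ^ 3) powr (\<Sum>X\<in>?G3. real (card X) / 3)"
  proof -
    have "0 < 1 + y ^ 3" using y by (simp add: add_pos_pos)
    then show ?thesis using fin by (subst powr_sum) auto
  qed
  also have "(\<Sum>X\<in>?G3. real (card X) / 3) = (real (card U) - real a - 2 * real d) / 3"
    using n by (simp add: sum_divide_distrib[symmetric] flip: of_nat_sum)
  finally have G3: "(\<Prod>X\<in>?G3. 1 + y ^ card X) \<le> (1 + y ^ 3) powr ((real (card U) - real a - 2 * real d) / 3)" .
  have "(\<Prod>X\<in>?G. 1 + y ^ card X)
      = (\<Prod>X\<in>?G1. 1 + y ^ card X) * ((\<Prod>X\<in>?G2. 1 + y ^ card X) * (\<Prod>X\<in>?G3. 1 + y ^ card X))"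
    using fin by (subst G, subst prod.union_disjoint, simp, simp, force, subst prod.union_disjoint) auto
  also have "\<dots> = (1 + y) ^ a * ((1 + y\<^sup>2) ^ d * (\<Prod>X\<in>?G3. 1 + y ^ card X))"
    by (simp add: a_def d_def)
  also have "\<dots> \<le> (1 + y) ^ a * ((1 + y\<^sup>2) ^ d * (1 + y ^ 3) powr ((real (card U) - real a - 2 * real d) / 3))"
    using y G3 by (intro mult_left_mono) auto
  finally show "(\<Prod>X\<in>?G. 1 + y ^ card X) \<le> gf_bound (card U) a d y"
    by (simp add: gf_bound_def mult.assoc)
qed

text \<open>A coefficient of a power series with nonnegative coefficients is bounded through the
  value of the series at any positive point. Prescribing a point \<open>x\<close> gains the factor
  \<open>y\<close>, which is what makes hitting probabilities small.\<close>

lemma card_inv_sets_le: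
  fixes y :: real and U :: "nat set"
  assumes U: "finite U" and p: "p permutes U" and y: "0 < y"
  defines "a \<equiv> card {X \<in> gen_orbits {p} U. card X = 1}"
    and "d \<equiv> card {X \<in> gen_orbits {p} U. card X = 2}"
  shows "real (card (inv_sets U p k)) * y ^ k \<le> gf_bound (card U) a d y"
    and "\<lbrakk>y \<le> 1; x \<in> U\<rbrakk> \<Longrightarrow>
      real (card {Z \<in> inv_sets U p k. x \<in> Z}) * y ^ k \<le> y * gf_bound (card U) a d y"
proof -
  have G: "(\<Prod>X\<in>gen_orbits {p} U. 1 + y ^ card X) \<le> gf_bound (card U) a d y"
    using orbit_prod_le(1)[OF U p y] unfolding a_def d_def .
  have "real (card (inv_sets U p k)) * y ^ k = (\<Sum>Z\<in>inv_sets U p k. y ^ card Z)"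
    by (simp add: inv_sets_def)
  also have "\<dots> \<le> (\<Sum>Z | Z \<subseteq> U \<and> invariant {p} Z. y ^ card Z)"
    using U y by (intro sum_mono2) (auto simp: inv_sets_def)
  finally show "real (card (inv_sets U p k)) * y ^ k \<le> gf_bound (card U) a d y"
    using sum_invariant_le_prod[OF U p y] G by linarith
  assume y1: "y \<le> 1" and x: "x \<in> U"
  have "real (card {Z \<in> inv_sets U p k. x \<in> Z}) * y ^ k = (\<Sum>Z\<in>{Z \<in> inv_sets U p k. x \<in> Z}. y ^ card Z)"
    by (simp add: inv_sets_def)
  also have "\<dots> \<le> (\<Sum>Z | Z \<subseteq> U \<and> invariant {p} Z \<and> x \<in> Z. y ^ card Z)"
    using U y by (intro sum_mono2) (auto simp: inv_sets_def)
  also have "\<dots> \<le> y * (\<Prod>X\<in>gen_orbits {p} U. 1 + y ^ card X)"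
    by (rule sum_invariant_containing_le_prod[OF U p y y1 x])
  also have "\<dots> \<le> y * gf_bound (card U) a d y" using G y by (intro mult_left_mono) auto
  finally show "real (card {Z \<in> inv_sets U p k. x \<in> Z}) * y ^ k \<le> y * gf_bound (card U) a d y" .
qed

text \<open>The point of the following bounds is that, compared with the entropy term, the binomial
  coefficient loses only a factor linear in \<open>k\<close>, not one depending on \<open>n\<close>.\<close>

lemma fact_exp_mono_Suc:
  assumes "1 \<le> m"
  shows "fact m * exp (real m) / real m ^ m \<le> fact (Suc m) * exp (real (Suc m)) / real (Suc m) ^ Suc m"
proof -
  \<comment> \<open>The ratio of consecutive terms of the sequence is
    \<open>exp 1 / (1 + 1 / m) ^ m\<close>.\<close>
  have "(1 + 1 / real m) ^ m \<le> exp 1"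
  proof -
    have "(1 + 1 / real m) ^ m \<le> exp (1 / real m) ^ m"
      by (intro power_mono) (auto simp: exp_ge_add_one_self add_nonneg_nonneg)
    then show ?thesis using assms by (simp add: exp_of_nat_mult[symmetric])
  qed
  moreover have "1 + 1 / real m = real (Suc m) / real m" using assms by (simp add: field_simps)
  ultimately have "real (Suc m) ^ m / real m ^ m \<le> exp 1" by (simp only: power_divide)
  then have "real (Suc m) ^ m \<le> exp 1 * real m ^ m"
    using assms by (simp only: pos_divide_le_eq zero_less_power of_nat_0_less_iff less_eq_Suc_le One_nat_def)
  then have "fact m * exp (real m) * real (Suc m) ^ m \<le> fact m * exp (real m) * (exp 1 * real m ^ m)"
    by (intro mult_left_mono) auto
  then have "fact m * exp (real m) / real m ^ m \<le> fact m * exp (real m) * exp 1 / real (Suc m) ^ m"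
    using assms by (simp add: field_simps del: of_nat_Suc)
  also have "\<dots> = (real (Suc m) * (fact m * exp (real m) * exp 1)) / (real (Suc m) * real (Suc m) ^ m)"
    by (simp del: of_nat_Suc)
  also have "\<dots> = fact (Suc m) * exp (real (Suc m)) / real (Suc m) ^ Suc m"
    by (simp add: exp_add mult_ac)
  finally show ?thesis .
qed

lemma fact_exp_mono:
  assumes "1 \<le> m" "m \<le> n"
  shows "fact m * exp (real m) / real m ^ m \<le> fact n * exp (real n) / real n ^ n"
  using assms(2)
proof (induction rule: dec_induct)
  case (step i)
  then show ?case using fact_exp_mono_Suc[of i] assms(1) by linarith
qed simp

text \<open>A crude upper Stirling bound. The induction step is
  \<open>(1 - 1 / (k + 1)) ^ (k + 1) \<le> exp (- 1)\<close>.\<close>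

lemma fact_exp_le:
  assumes "1 \<le> k"
  shows "fact k * exp (real k) \<le> exp 1 * real k * real k ^ k"
  using assms
proof (induction k rule: dec_induct)
  case (step k)
  have k: "0 < real k" using step.hyps by simp
  have "(1 - 1 / real (Suc k)) ^ Suc k \<le> exp (- 1 / real (Suc k)) ^ Suc k"
    using exp_ge_add_one_self[of "- 1 / real (Suc k)"] by (intro power_mono) auto
  also have "\<dots> = exp (- 1)" by (simp add: exp_of_nat_mult[symmetric] del: power_Suc of_nat_Suc)
  also have "1 - 1 / real (Suc k) = real k / real (Suc k)" by (simp add: field_simps)
  finally have *: "exp 1 * real k ^ Suc k \<le> real (Suc k) ^ Suc k"
    by (simp add: power_divide exp_minus field_simps del: power_Suc of_nat_Suc)
  have "fact (Suc k) * exp (real (Suc k)) = real (Suc k) * exp 1 * (fact k * exp (real k))"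
    by (simp add: exp_add algebra_simps)
  also have "\<dots> \<le> real (Suc k) * exp 1 * (exp 1 * real k * real k ^ k)"
    using step.IH by (intro mult_left_mono) auto
  also have "\<dots> = real (Suc k) * exp 1 * (exp 1 * real k ^ Suc k)" by simp
  also have "\<dots> \<le> real (Suc k) * exp 1 * real (Suc k) ^ Suc k"
    using * by (intro mult_left_mono) auto
  finally show ?case by (simp only: mult_ac)
qed simp

text \<open>The left side is the entropy term \<open>n ^ n / ((n - k) ^ (n - k) * k ^ k)\<close>.
  Comparing \<open>fact n\<close> with \<open>fact (n - k)\<close> by monotonicity costs nothing;
  only the estimate of \<open>fact k\<close> costs \<open>exp 1 * k\<close>.\<close>

lemma binomial_lower_bound:
  assumes k: "1 \<le> k" "k < n"
  shows "(real n / real (n - k)) ^ (n - k) * (real n / real k) ^ k \<le> exp 1 * real k * real (n choose k)"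
proof -
  let ?m = "n - k"
  have n: "n = ?m + k" using k by simp
  have pos: "0 < real ?m" "0 < real k" "0 < real n" using k by auto
  have 1: "fact ?m * exp (real ?m) * real n ^ n \<le> fact n * exp (real n) * real ?m ^ ?m"
    using fact_exp_mono[of ?m n] k pos by (simp add: field_simps)
  have 2: "fact k * exp (real k) \<le> exp 1 * real k * real k ^ k" using fact_exp_le[OF k(1)] .
  have "real n ^ n * (fact ?m * fact k) * exp (real n)
      = (fact ?m * exp (real ?m) * real n ^ n) * (fact k * exp (real k))"
    using n by (metis (no_types, lifting) exp_add mult.assoc mult.commute of_nat_add)
  also have "\<dots> \<le> (fact n * exp (real n) * real ?m ^ ?m) * (exp 1 * real k * real k ^ k)"
    by (rule mult_mono[OF 1 2]) simp_all
  finally have 3: "real n ^ n * (fact ?m * fact k) \<le> fact n * real ?m ^ ?m * (exp 1 * real k * real k ^ k)"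
    by (simp add: mult_ac)
  have c: "real (n choose k) = fact n / (fact k * fact ?m)" using k by (simp add: binomial_fact)
  have "real n ^ ?m * real n ^ k = real n ^ n" using n by (metis power_add)
  then show ?thesis
    using 3 pos by (simp add: c power_divide field_simps)
qed

section \<open>Evaluating the generating functions at suitable points\<close>

text \<open>For equal mass, 3-cycles contribute strictly less than 2-cycles. The exponential factor
  quantifies the gain and is the source of decay when a positive proportion of points lies outside
  2-cycles.\<close>

lemma cube_square_ratio:
  fixes y :: real
  assumes y: "0 < y" "y \<le> 1"
  shows "(1 + y ^ 3) powr (2/3) \<le> (1 + y\<^sup>2) * exp (- (y\<^sup>2 / 10))"
proof -
  have y2: "0 < y\<^sup>2" "y\<^sup>2 \<le> 1" using y by (auto simp: power_le_one)
  have y3: "0 \<le> y ^ 3" "y ^ 3 \<le> 1" using y by (auto simp: power_le_one)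
  have "exp (3 * y\<^sup>2 / 10) \<le> 1 + 2/3 * y\<^sup>2"
  proof -
    define x where "x = 2/3 * y\<^sup>2"
    have x: "0 < x" "x \<le> 2/3" using y2 by (auto simp: x_def)
    have "- ln (1 + x) = ln (1 / (1 + x))" using x by (simp add: ln_div)
    also have "\<dots> \<le> 1 / (1 + x) - 1" using x by (intro ln_le_minus_one) auto
    also have "\<dots> = - (x / (1 + x))" using x by (simp add: field_simps)
    also have "\<dots> \<le> - (x / 2)" using x frac_le[of x x "1 + x" 2] by simp
    finally have "x / 2 \<le> ln (1 + x)" by simp
    then have "3 * y\<^sup>2 / 10 \<le> ln (1 + x)" using x_def y2 by linarith
    then have "exp (3 * y\<^sup>2 / 10) \<le> exp (ln (1 + x))" by (rule exp_le_cancel_iff[THEN iffD2])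
    also have "\<dots> = 1 + x" using x by (intro exp_ln) auto
    finally show ?thesis unfolding x_def .
  qed
  moreover have "(1 + y ^ 3)\<^sup>2 * (1 + 2/3 * y\<^sup>2) \<le> (1 + y\<^sup>2) ^ 3"
  proof -
    have "(1 + y ^ 3)\<^sup>2 \<le> 4" using power_mono[of "1 + y ^ 3" 2 2] y3 by simp
    then have 1: "(1 + y ^ 3)\<^sup>2 * (2/3 * y\<^sup>2) \<le> 4 * (2/3 * y\<^sup>2)" using y2 by (intro mult_right_mono) auto
    \<comment> \<open>Completing the square shows that the surplus over
      \<open>(1 + y ^ 3)\<^sup>2\<close> is at least \<open>8 / 3\<close> times the square of
      \<open>y\<close>, which is exactly the \<open>4 * (2 / 3)\<close> required above.\<close>
    have 2: "(1 + y\<^sup>2) ^ 3 = (1 + y ^ 3)\<^sup>2 + y\<^sup>2 * (3 * (y - 1/3)\<^sup>2 + 8/3)"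
      by (simp add: power2_eq_square power3_eq_cube algebra_simps)
    have 3: "y\<^sup>2 * (8/3) \<le> y\<^sup>2 * (3 * (y - 1/3)\<^sup>2 + 8/3)" using y2 by (intro mult_left_mono) auto
    have "(1 + y ^ 3)\<^sup>2 * (1 + 2/3 * y\<^sup>2) = (1 + y ^ 3)\<^sup>2 + (1 + y ^ 3)\<^sup>2 * (2/3 * y\<^sup>2)"
      by (simp add: distrib_left)
    then show ?thesis using 1 2 3 by linarith
  qed
  ultimately have "(1 + y ^ 3)\<^sup>2 * exp (3 * y\<^sup>2 / 10) \<le> (1 + y\<^sup>2) ^ 3"
    by (meson mult_left_mono order_trans zero_le_power2)
  then have "(1 + y ^ 3)\<^sup>2 \<le> (1 + y\<^sup>2) ^ 3 * exp (- (3 * y\<^sup>2 / 10))"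
    by (simp add: exp_minus field_simps)
  also have "\<dots> = ((1 + y\<^sup>2) * exp (- (y\<^sup>2 / 10))) ^ 3"
    by (simp add: power_mult_distrib exp_of_nat_mult[symmetric])
  also have "(1 + y ^ 3)\<^sup>2 = ((1 + y ^ 3) powr (2/3)) ^ 3"
  proof -
    have p: "0 < 1 + y ^ 3" using y3(1) by linarith
    then have "((1 + y ^ 3) powr (2/3)) ^ 3 = (1 + y ^ 3) powr (2/3 * 3)"
      by (simp add: powr_power)
    moreover have "(1 + y ^ 3) powr 2 = (1 + y ^ 3)\<^sup>2" using p by (intro powr_numeral) auto
    ultimately show ?thesis by simp
  qed
  finally show ?thesis by (subst (asm) power_mono_iff) auto
qed

lemma power_le_exp:
  fixes x :: real
  assumes "0 \<le> x"
  shows "(1 + x) ^ m \<le> exp (real m * x)"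
proof -
  have "(1 + x) ^ m \<le> exp x ^ m" using assms by (intro power_mono) auto
  then show ?thesis by (simp add: exp_of_nat_mult)
qed

lemma gf_bound_pos: "0 < y \<Longrightarrow> 0 < gf_bound n a d y"
  using add_pos_pos[of 1 "y ^ 3"] add_pos_nonneg[of 1 "y\<^sup>2"]
  unfolding gf_bound_def by (intro mult_pos_pos zero_less_power) auto

lemma gf_bound_le_exp:
  assumes "0 < y" "a + 2 * d \<le> n"
  shows "gf_bound n a d y \<le> exp (real a * y + real d * y\<^sup>2 + real n * y ^ 3 / 3)"
proof -
  have p: "0 < 1 + y ^ 3" "0 \<le> y ^ 3" using assms by (auto simp: add_pos_pos)
  have "(1 + y ^ 3) powr ((real n - real a - 2 * real d) / 3) \<le> (1 + y ^ 3) powr (real n / 3)"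
    using p by (intro powr_mono) auto
  also have "\<dots> \<le> exp (y ^ 3) powr (real n / 3)"
    using p by (intro powr_mono2) auto
  also have "\<dots> = exp (real n * y ^ 3 / 3)" by (simp add: powr_def mult.commute)
  finally have "(1 + y ^ 3) powr ((real n - real a - 2 * real d) / 3) \<le> exp (real n * y ^ 3 / 3)" .
  moreover have "(1 + y) ^ a \<le> exp (real a * y)" "(1 + y\<^sup>2) ^ d \<le> exp (real d * y\<^sup>2)"
    using assms by (auto intro: power_le_exp)
  ultimately show ?thesis
    unfolding gf_bound_def exp_add using assms by (intro mult_mono) auto
qed

text \<open>The point \<open>y\<close> minimises \<open>(1 + y\<^sup>2) ^ n / y ^ (2 * k)\<close>,
  the bound that would arise if both permutations consisted of 2-cycles. There it equals the entropy
  term. Fixed points cost \<open>exp (3 * \<eta> * k)\<close>, while the mass outside 2-cycles gains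
  \<open>exp (- \<epsilon> * k / 10)\<close>.\<close>

lemma gf_bound_balanced:
  fixes \<eta> \<epsilon> :: real
  assumes k: "1 \<le> k" "2 * k \<le> n" and \<epsilon>: "0 < \<epsilon>"
    and sz: "a + 2 * d \<le> n" "a' + 2 * d' \<le> n" and dd: "real d + real d' \<le> (1 - \<epsilon>) * real n"
    and a: "real a \<le> \<eta> * sqrt (real k * real n)" "real a' \<le> \<eta> * sqrt (real k * real n)"
  defines "y \<equiv> sqrt (real k / real (n - k))"
  shows "0 < y" "y \<le> 1" "y\<^sup>2 \<le> 2 * real k / real n"
    and "gf_bound n a d y * gf_bound n a' d' y
      \<le> (y * y) ^ k * (real (n choose k) * (exp 1 * real k * exp (3 * \<eta> * real k - \<epsilon> * real k / 10)))"
proof -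
  have pos: "0 < real k" "0 < real n" "0 < real (n - k)" "k < n" "real (n - k) = real n - real k" using k by auto
  have y2: "y\<^sup>2 = real k / real (n - k)" using pos by (simp add: y_def)
  show y0: "0 < y" using pos by (simp add: y_def)
  have y2': "y\<^sup>2 \<le> 1" using pos k by (simp add: y2)
  show y1: "y \<le> 1" using y2' by (intro power2_le_imp_le[of y 1]) auto
  show yk: "y\<^sup>2 \<le> 2 * real k / real n"
    unfolding y2 using pos k by (simp add: field_simps) 
  have yk': "real k / real n \<le> y\<^sup>2" unfolding y2 using pos by (simp add: field_simps)
  have \<eta>0: "0 \<le> \<eta>"
    using a(1) pos by (metis mult_pos_pos not_less of_nat_0_le_iff order_trans real_sqrt_gt_zero zero_le_mult_iff)
  \<comment> \<open>The number of fixed points times \<open>y\<close> is of order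
    \<open>\<eta> * k\<close>, since \<open>sqrt (k * n) * y\<close> is at most
    \<open>sqrt 2 * k\<close>, hence at most \<open>3 / 2 * k\<close>.\<close>
  have e1: "(1 + y) ^ (a + a') \<le> exp (3 * \<eta> * real k)"
  proof -
    have "(real a + real a') * y \<le> (2 * \<eta> * sqrt (real k * real n)) * y"
      using a y0 by (intro mult_right_mono) auto
    also have "\<dots> = 2 * \<eta> * (sqrt (real k * real n) * y)" by simp
    also have "sqrt (real k * real n) * y \<le> 3 / 2 * real k"
    proof (rule power2_le_imp_le)
      have "(sqrt (real k * real n) * y)\<^sup>2 = real k * real n * y\<^sup>2" using pos by (simp add: power_mult_distrib)
      also have "\<dots> \<le> real k * real n * (2 * real k / real n)" using yk pos by (intro mult_left_mono) auto
      also have "\<dots> = 2 * (real k)\<^sup>2" using pos by (simp add: power2_eq_square)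
      also have "\<dots> \<le> (3 / 2 * real k)\<^sup>2" by (simp add: power_mult_distrib power2_eq_square)
      finally show "(sqrt (real k * real n) * y)\<^sup>2 \<le> (3 / 2 * real k)\<^sup>2" .
    qed simp
    finally have "(real a + real a') * y \<le> 3 * \<eta> * real k" using \<eta>0 by (simp add: mult_left_mono)
    then have "exp (real (a + a') * y) \<le> exp (3 * \<eta> * real k)" by simp
    then show ?thesis using power_le_exp[of y "a + a'"] y0 by linarith
  qed
  let ?D = "real d + real d'"
  have D: "0 \<le> real n - ?D" "\<epsilon> * real n \<le> real n - ?D"
    using dd \<epsilon> sz by (auto simp: algebra_simps)
  have p3: "1 \<le> 1 + y ^ 3" using y0 by simp
  have p2: "0 < 1 + y\<^sup>2" by (simp add: add_pos_nonneg)
  \<comment> \<open>The exponents of both permutations together are at most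
    \<open>2 / 3 * (n - d - d')\<close>. Each \<open>2 / 3\<close> power is traded for a 2-cycle
    factor with a gain, and at least \<open>\<epsilon> * n\<close> such trades occur.\<close>
  have "(1 + y ^ 3) powr ((real n - real a - 2 * real d) / 3) * (1 + y ^ 3) powr ((real n - real a' - 2 * real d') / 3)
      = (1 + y ^ 3) powr ((real n - real a - 2 * real d) / 3 + (real n - real a' - 2 * real d') / 3)"
    by (rule powr_add[symmetric])
  also have "\<dots> \<le> (1 + y ^ 3) powr (2 / 3 * (real n - ?D))"
    using p3 by (intro powr_mono) (auto simp: field_simps)
  also have "\<dots> = ((1 + y ^ 3) powr (2 / 3)) powr (real n - ?D)" by (simp add: powr_powr)
  also have "\<dots> \<le> ((1 + y\<^sup>2) * exp (- (y\<^sup>2 / 10))) powr (real n - ?D)"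
    using D p3 cube_square_ratio[OF y0 y1] by (intro powr_mono2) auto
  also have "\<dots> = (1 + y\<^sup>2) powr (real n - ?D) * exp (- (y\<^sup>2 / 10) * (real n - ?D))"
    using p2 by (simp add: powr_mult powr_def[of "exp _"] mult.commute)
  also have "\<dots> \<le> (1 + y\<^sup>2) powr (real n - ?D) * exp (- (\<epsilon> * real k / 10))"
  proof -
    have "real k / real n * (\<epsilon> * real n) \<le> y\<^sup>2 * (real n - ?D)"
      using yk' D pos \<epsilon> by (intro mult_mono) auto
    then have "\<epsilon> * real k / 10 \<le> y\<^sup>2 / 10 * (real n - ?D)" using pos by (simp add: mult.commute)
    then show ?thesis by (intro mult_left_mono) auto
  qed
  finally have e3: "(1 + y ^ 3) powr ((real n - real a - 2 * real d) / 3) * (1 + y ^ 3) powr ((real n - real a' - 2 * real d') / 3)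
      \<le> (1 + y\<^sup>2) powr (real n - ?D) * exp (- (\<epsilon> * real k / 10))" .
  have e4: "(1 + y\<^sup>2) ^ (d + d') * (1 + y\<^sup>2) powr (real n - ?D) = (1 + y\<^sup>2) ^ n"
    using p2 by (simp add: powr_realpow[symmetric] powr_add[symmetric])
  have e5: "(1 + y\<^sup>2) ^ n \<le> (y * y) ^ k * (exp 1 * real k * real (n choose k))"
  proof -
    have "1 + y\<^sup>2 = real n / real (n - k)" unfolding y2 using pos by (simp add: field_simps)
    moreover have "(real n / real (n - k)) ^ n = (y * y) ^ k * ((real n / real (n - k)) ^ (n - k) * (real n / real k) ^ k)"
    proof -
      have "(real n / real (n - k)) ^ n = (real n / real (n - k)) ^ (n - k) * (real n / real (n - k)) ^ k"
        using pos by (simp flip: power_add)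
      also have "(real n / real (n - k)) ^ k = (real n / real k) ^ k * (y * y) ^ k"
      proof -
        have "real n / real (n - k) = real n / real k * (y * y)"
          using y2 pos by (simp add: power2_eq_square)
        then show ?thesis by (simp only: power_mult_distrib)
      qed
      finally show ?thesis by (simp only: mult_ac)
    qed
    ultimately show ?thesis
      using binomial_lower_bound[OF k(1) pos(4)] by (simp add: mult_left_mono)
  qed
  have "gf_bound n a d y * gf_bound n a' d' y = (1 + y) ^ (a + a') * ((1 + y\<^sup>2) ^ (d + d') *
      ((1 + y ^ 3) powr ((real n - real a - 2 * real d) / 3) * (1 + y ^ 3) powr ((real n - real a' - 2 * real d') / 3)))"
    unfolding gf_bound_def power_add by (simp only: mult_ac)
  also have "\<dots> \<le> exp (3 * \<eta> * real k) * ((1 + y\<^sup>2) ^ (d + d') * ((1 + y\<^sup>2) powr (real n - ?D) * exp (- (\<epsilon> * real k / 10))))"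
    using y0 by (intro mult_mono e1 mult_left_mono e3) auto
  also have "\<dots> = exp (3 * \<eta> * real k - \<epsilon> * real k / 10) * (1 + y\<^sup>2) ^ n"
  proof -
    have "exp (3 * \<eta> * real k - \<epsilon> * real k / 10) = exp (3 * \<eta> * real k) * exp (- (\<epsilon> * real k / 10))"
      by (simp flip: exp_add)
    then show ?thesis unfolding e4[symmetric] by (simp only: mult_ac)
  qed
  also have "\<dots> \<le> exp (3 * \<eta> * real k - \<epsilon> * real k / 10) * ((y * y) ^ k * (exp 1 * real k * real (n choose k)))"
    by (intro mult_left_mono e5) auto
  finally show "gf_bound n a d y * gf_bound n a' d' y
      \<le> (y * y) ^ k * (real (n choose k) * (exp 1 * real k * exp (3 * \<eta> * real k - \<epsilon> * real k / 10)))"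
    by (simp only: mult_ac)
qed

text \<open>If \<open>p\<close> has many fixed points, the two generating functions are evaluated at different points
  with product \<open>k / n\<close>. The contribution of the 3-cycles of \<open>q\<close> is then controlled by \<open>a ^ 3 / n\<^sup>2\<close>,
  which is where \<open>a = o(n powr (2/3))\<close> is needed.\<close>

lemma gf_bound_unbalanced:
  fixes \<eta> B :: real
  assumes k: "1 \<le> k" "2 * k \<le> n" and \<eta>: "0 < \<eta>" "\<eta> \<le> 1 / 12"
    and sz: "a + 2 * d \<le> n" "a' + 2 * d' \<le> n"
    and a: "\<eta> * sqrt (real k * real n) < real a"
    and prod1: "real a * real a' \<le> B * real n" and prod2: "(real a)\<^sup>2 * real d' \<le> B\<^sup>2 * (real n)\<^sup>2"
    and cube: "real a ^ 3 \<le> \<eta> ^ 3 * (real n)\<^sup>2" and n: "1 \<le> \<eta> ^ 3 * real n"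
  defines "y \<equiv> \<eta> * real k / real a" and "y' \<equiv> real a / (\<eta> * real n)"
  shows "0 < y" "y < y'" "y' \<le> 1" "y' ^ 3 \<le> 1 / real n"
    and "gf_bound n a d y * gf_bound n a' d' y'
      \<le> (y * y') ^ k * (real (n choose k) * (exp 1 * real k * exp (B / \<eta> + B\<^sup>2 / \<eta>\<^sup>2 + 1 - real k / 4)))"
proof -
  have pos: "0 < real k" "0 < real n" "0 < real (n - k)" "k < n" "real (n - k) = real n - real k" using k by auto
  have a0: "0 < real a" using a \<eta> pos by (meson mult_pos_pos less_trans real_sqrt_gt_zero)
  show y0: "0 < y" using pos a0 \<eta> by (simp add: y_def)
  have y0': "0 < y'" using pos a0 \<eta> by (simp add: y'_def)
  have yy: "y * y' = real k / real n" using pos a0 \<eta> by (simp add: y_def y'_def field_simps)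
  have "(\<eta> * sqrt (real k * real n))\<^sup>2 < (real a)\<^sup>2" using a \<eta> pos by (intro power_strict_mono) auto
  then have a2: "\<eta>\<^sup>2 * (real k * real n) < (real a)\<^sup>2" using pos by (simp add: power_mult_distrib)
  \<comment> \<open>This is the hypothesis that \<open>a\<close> exceeds
    \<open>\<eta> * sqrt (k * n)\<close>, rewritten. Smallness of \<open>y'\<close> therefore also
    gives smallness of \<open>y\<close>.\<close>
  show ylt: "y < y'"
    unfolding y_def y'_def using a2 pos a0 \<eta> by (simp add: field_simps power2_eq_square)
  show y3: "y' ^ 3 \<le> 1 / real n"
    unfolding y'_def using cube pos \<eta> by (simp add: field_simps power_divide power_mult_distrib power3_eq_cube power2_eq_square)
  have "1 / real n \<le> \<eta> ^ 3" using n pos by (simp add: field_simps)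
  with y3 have "y' ^ 3 \<le> \<eta> ^ 3" by (rule order_trans)
  then have yeta: "y' \<le> \<eta>" using \<eta> y0' by (meson less_imp_le power_le_imp_le_base power_mono_iff zero_less_numeral)
  then show "y' \<le> 1" using \<eta> by linarith
  have kn: "real k / real n \<le> \<eta>"
  proof -
    have "real k / real n \<le> y' * y'" unfolding yy[symmetric] using ylt y0' by (intro mult_right_mono) auto
    also have "\<dots> \<le> \<eta> * 1" using yeta y0' \<eta> by (intro mult_mono) auto
    finally show ?thesis by simp
  qed
  have t1: "real a * y = \<eta> * real k" using a0 by (simp add: y_def)
  have y2: "y\<^sup>2 \<le> real k / real n"
    unfolding yy[symmetric] power2_eq_square using ylt y0 by (intro mult_left_mono) auto
  \<comment> \<open>As \<open>d\<close> is at most \<open>n / 2\<close>, the 2-cycles of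
    \<open>p\<close> use only half of the exponent \<open>k\<close> that the binomial coefficient
    supplies. The other terms for \<open>p\<close> are small multiples of \<open>k\<close>, and
    those for \<open>q\<close> are bounded by constants.\<close>
  have t2: "real d * y\<^sup>2 \<le> real k / 2"
  proof -
    have "real d * y\<^sup>2 \<le> (real n / 2) * (real k / real n)" using sz y2 by (intro mult_mono) auto
    then show ?thesis using pos by simp
  qed
  have t3: "real n * y ^ 3 / 3 \<le> \<eta> * real k / 3"
  proof -
    have "y ^ 3 = y\<^sup>2 * y" by (simp add: power2_eq_square power3_eq_cube)
    also have "\<dots> \<le> real k / real n * \<eta>" using y2 yeta ylt y0 pos by (intro mult_mono) auto
    finally show ?thesis using pos by (simp add: field_simps)
  qed
  have t4: "real a' * y' \<le> B / \<eta>"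
    unfolding y'_def using prod1 pos \<eta> by (simp add: field_simps)
  have t5: "real d' * y'\<^sup>2 \<le> B\<^sup>2 / \<eta>\<^sup>2"
    unfolding y'_def using prod2 pos \<eta> by (simp add: field_simps power_divide power_mult_distrib)
  have t6: "real n * y' ^ 3 / 3 \<le> 1"
    using y3 pos by (simp add: field_simps)
  have G: "gf_bound n a d y * gf_bound n a' d' y' \<le> exp (\<eta> * real k + real k / 2 + \<eta> * real k / 3 + (B / \<eta> + B\<^sup>2 / \<eta>\<^sup>2 + 1))"
  proof -
    have "gf_bound n a d y * gf_bound n a' d' y' \<le>
        exp (real a * y + real d * y\<^sup>2 + real n * y ^ 3 / 3) * exp (real a' * y' + real d' * y'\<^sup>2 + real n * y' ^ 3 / 3)"
      using gf_bound_le_exp y0 y0' sz gf_bound_pos by (intro mult_mono) (auto simp: less_imp_le)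
    also have "\<dots> \<le> exp (\<eta> * real k + real k / 2 + \<eta> * real k / 3 + (B / \<eta> + B\<^sup>2 / \<eta>\<^sup>2 + 1))"
      unfolding exp_add[symmetric] using t1 t2 t3 t4 t5 t6 by simp
    finally show ?thesis .
  qed
  \<comment> \<open>Since \<open>k / n\<close> is at most \<open>\<eta>\<close>, the first entropy
    factor is almost \<open>exp k\<close>.\<close>
  have bin: "exp (real k - \<eta> * real k) * (real n / real k) ^ k \<le> exp 1 * real k * real (n choose k)"
  proof -
    have "exp (real k / real n) \<le> real n / real (n - k)"
    proof -
      have "1 - real k / real n \<le> exp (- (real k / real n))"
        using exp_ge_add_one_self[of "- (real k / real n)"] by simp
      then show ?thesis using pos by (simp add: exp_minus field_simps)
    qed
    then have "exp (real k / real n) ^ (n - k) \<le> (real n / real (n - k)) ^ (n - k)"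
      by (intro power_mono) auto
    moreover have "exp (real k - \<eta> * real k) \<le> exp (real k / real n) ^ (n - k)"
    proof -
      have "real k * (real k / real n) \<le> real k * \<eta>" using kn by (intro mult_left_mono) auto
      then have "real k - \<eta> * real k \<le> real (n - k) * (real k / real n)"
        using pos by (simp add: field_simps)
      then show ?thesis by (simp add: exp_of_nat_mult[symmetric])
    qed
    ultimately have "exp (real k - \<eta> * real k) \<le> (real n / real (n - k)) ^ (n - k)" by linarith
    then have "exp (real k - \<eta> * real k) * (real n / real k) ^ k \<le> (real n / real (n - k)) ^ (n - k) * (real n / real k) ^ k"
      by (intro mult_right_mono) auto
    then show ?thesis using binomial_lower_bound[OF k(1) pos(4)] by linarith
  qed
  let ?E = "B / \<eta> + B\<^sup>2 / \<eta>\<^sup>2 + 1 - real k / 4"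
  \<comment> \<open>The terms containing \<open>\<eta>\<close> add up to
    \<open>7 / 3 * \<eta> * k\<close>, at most \<open>7 / 36 * k\<close>. Of the spare
    \<open>k / 2\<close>, at least \<open>k / 4\<close> remains as decay.\<close>
  have "\<eta> * real k \<le> 1 / 12 * real k" using \<eta> by (intro mult_right_mono) auto
  then have "\<eta> * real k + real k / 2 + \<eta> * real k / 3 + (B / \<eta> + B\<^sup>2 / \<eta>\<^sup>2 + 1) \<le> ?E + (real k - \<eta> * real k)"
    by simp
  then have "gf_bound n a d y * gf_bound n a' d' y' \<le> exp (?E + (real k - \<eta> * real k))"
    using G by (meson exp_le_cancel_iff order_trans)
  also have "\<dots> = exp ?E * (y * y') ^ k * (exp (real k - \<eta> * real k) * (real n / real k) ^ k)"
    unfolding yy exp_add using pos by (simp add: power_divide)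
  also have "\<dots> \<le> exp ?E * (y * y') ^ k * (exp 1 * real k * real (n choose k))"
    using y0 y0' by (intro mult_left_mono bin) auto
  finally show "gf_bound n a d y * gf_bound n a' d' y'
      \<le> (y * y') ^ k * (real (n choose k) * (exp 1 * real k * exp ?E))"
    by (simp only: mult_ac)
qed

text \<open>With \<open>\<eta> = \<epsilon> / 60\<close> the unbalanced estimate applies when either
  permutation has more than \<open>\<eta> * sqrt (k * n)\<close> fixed points, and the balanced one
  otherwise, where the net exponent is
  \<open>3 * \<eta> * k - \<epsilon> * k / 10 = - \<epsilon> * k / 20\<close>. The constant
  \<open>A\<close> collects \<open>B / \<eta>\<close>, its square and the factor
  \<open>exp 1\<close>. The size bounds on \<open>y\<close> and \<open>y'\<close> are kept for the
  hitting probabilities.\<close>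

lemma saddle_point:
  fixes \<epsilon> B :: real
  assumes k: "1 \<le> k" "2 * k \<le> n" and \<epsilon>: "0 < \<epsilon>" "\<epsilon> \<le> 1" and B: "0 < B"
    and sz: "a + 2 * d \<le> n" "a' + 2 * d' \<le> n" and dd: "real d + real d' \<le> (1 - \<epsilon>) * real n"
    and prod: "real a * real a' \<le> B * real n" "(real a)\<^sup>2 * real d' \<le> B\<^sup>2 * (real n)\<^sup>2"
      "(real a')\<^sup>2 * real d \<le> B\<^sup>2 * (real n)\<^sup>2"
    and cube: "real a ^ 3 \<le> (\<epsilon> / 60) ^ 3 * (real n)\<^sup>2" "real a' ^ 3 \<le> (\<epsilon> / 60) ^ 3 * (real n)\<^sup>2"
    and n: "1 \<le> (\<epsilon> / 60) ^ 3 * real n"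
  defines "A \<equiv> exp (60 * B / \<epsilon> + 3600 * B\<^sup>2 / \<epsilon>\<^sup>2 + 2) * 40 / \<epsilon>" and "r \<equiv> exp (- (\<epsilon> / 40))"
  obtains y y' :: real where "0 < y" "y \<le> 1" "0 < y'" "y' \<le> 1"
    "y\<^sup>2 \<le> 2 * real k / real n \<or> y ^ 3 \<le> 1 / real n" "y'\<^sup>2 \<le> 2 * real k / real n \<or> y' ^ 3 \<le> 1 / real n"
    "gf_bound n a d y * gf_bound n a' d' y' \<le> (y * y') ^ k * (real (n choose k) * (A * r ^ k))"
proof -
  let ?c0 = "60 * B / \<epsilon> + 3600 * B\<^sup>2 / \<epsilon>\<^sup>2 + 1"
  have A0: "exp 1 * real k * exp x \<le> A * r ^ k" if x: "x \<le> ?c0 - \<epsilon> * real k / 20" for x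
  proof -
    \<comment> \<open>The decay \<open>exp (- \<epsilon> * k / 20)\<close> is split in two: one half
      absorbs the factor \<open>k\<close> of the binomial bound at cost
      \<open>40 / \<epsilon>\<close>, the other becomes \<open>r ^ k\<close>.\<close>
    have lin: "real k * exp (- (\<epsilon> * real k / 40)) \<le> 40 / \<epsilon>"
    proof -
      have "\<epsilon> * real k / 40 \<le> exp (\<epsilon> * real k / 40)"
        using exp_ge_add_one_self[of "\<epsilon> * real k / 40"] by linarith
      then show ?thesis using \<epsilon> by (simp add: exp_minus field_simps)
    qed
    have rk: "r ^ k = exp (- (\<epsilon> * real k / 40))"
      unfolding r_def by (simp add: exp_of_nat_mult[symmetric] mult.commute)
    have *: "real k * exp (- (\<epsilon> * real k / 40)) * exp (- (\<epsilon> * real k / 40)) \<le> 40 / \<epsilon> * r ^ k"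
      unfolding rk by (rule mult_right_mono[OF lin]) simp
    have "exp 1 * real k * exp x \<le> exp 1 * real k * exp (?c0 - \<epsilon> * real k / 20)"
      using x by (intro mult_left_mono) auto
    also have "exp (?c0 - \<epsilon> * real k / 20) = exp ?c0 * (exp (- (\<epsilon> * real k / 40)) * exp (- (\<epsilon> * real k / 40)))"
      by (simp flip: exp_add)
    also have "exp 1 * real k * (exp ?c0 * (exp (- (\<epsilon> * real k / 40)) * exp (- (\<epsilon> * real k / 40))))
        = (exp 1 * exp ?c0) * (real k * exp (- (\<epsilon> * real k / 40)) * exp (- (\<epsilon> * real k / 40)))"
      by (simp only: mult_ac)
    also have "\<dots> \<le> (exp 1 * exp ?c0) * (40 / \<epsilon> * r ^ k)"
      by (rule mult_left_mono[OF *]) simp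
    also have "\<dots> = A * r ^ k" by (simp add: A_def flip: exp_add)
    finally show ?thesis .
  qed
  have A: "(z::real) * (real (n choose k) * (exp 1 * real k * exp x)) \<le> z * (real (n choose k) * (A * r ^ k))"
    if "0 \<le> z" "x \<le> ?c0 - \<epsilon> * real k / 20" for x z
    by (intro mult_left_mono A0 that) auto
  have unb: "?c0 - real k / 4 \<le> ?c0 - \<epsilon> * real k / 20"
  proof -
    have "\<epsilon> * real k \<le> 1 * real k" using \<epsilon> by (intro mult_right_mono) auto
    then show ?thesis by simp
  qed
  have c0: "B / (\<epsilon> / 60) + B\<^sup>2 / (\<epsilon> / 60)\<^sup>2 + 1 = ?c0" using \<epsilon> by (simp add: power_divide field_simps)
  have eta: "0 < \<epsilon> / 60" "\<epsilon> / 60 \<le> 1 / 12" using \<epsilon> by auto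
  have prod': "real a' * real a \<le> B * real n" using prod(1) by (simp add: mult.commute)
  consider (1) "\<epsilon> / 60 * sqrt (real k * real n) < real a"
    | (2) "\<epsilon> / 60 * sqrt (real k * real n) < real a'"
    | (3) "real a \<le> \<epsilon> / 60 * sqrt (real k * real n)" "real a' \<le> \<epsilon> / 60 * sqrt (real k * real n)"
    by linarith
  then show thesis
  proof cases
    case 1
    note u = gf_bound_unbalanced[OF k eta sz 1 prod(1,2) cube(1) n, unfolded c0]
    define y where "y = \<epsilon> / 60 * real k / real a"
    define y' where "y' = real a / (\<epsilon> / 60 * real n)"
    note u = u[folded y_def y'_def]
    have "y ^ 3 \<le> y' ^ 3" using u(1,2) by (intro power_mono) auto
    then have "y ^ 3 \<le> 1 / real n" using u(4) by linarith
    moreover have "gf_bound n a d y * gf_bound n a' d' y' \<le> (y * y') ^ k * (real (n choose k) * (A * r ^ k))"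
      using u(1,2) by (intro order_trans[OF u(5) A[OF _ unb]]) auto
    ultimately show thesis using u(1-4) by (intro that[of y y']) auto
  next
    case 2
    note u = gf_bound_unbalanced[OF k eta sz(2,1) 2 prod' prod(3) cube(2) n, unfolded c0]
    define y' where "y' = \<epsilon> / 60 * real k / real a'"
    define y where "y = real a' / (\<epsilon> / 60 * real n)"
    note u = u[folded y_def y'_def]
    have "y' ^ 3 \<le> y ^ 3" using u(1,2) by (intro power_mono) auto
    then have "y' ^ 3 \<le> 1 / real n" using u(4) by linarith
    moreover have "gf_bound n a' d' y' * gf_bound n a d y \<le> (y' * y) ^ k * (real (n choose k) * (A * r ^ k))"
      using u(1,2) by (intro order_trans[OF u(5) A[OF _ unb]]) auto
    ultimately show thesis using u(1-4) by (intro that[of y y']) (auto simp: mult.commute)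
  next
    case 3
    note u = gf_bound_balanced[OF k \<epsilon>(1) sz dd 3]
    define y where "y = sqrt (real k / real (n - k))"
    note u = u[folded y_def]
    have "3 * (\<epsilon> / 60) * real k - \<epsilon> * real k / 10 \<le> ?c0 - \<epsilon> * real k / 20"
      using \<epsilon> B by (simp add: add_nonneg_nonneg)
    then have "gf_bound n a d y * gf_bound n a' d' y \<le> (y * y) ^ k * (real (n choose k) * (A * r ^ k))"
      using u(1) by (intro order_trans[OF u(4) A]) auto
    then show thesis using u(1-3) by (intro that[of y y]) auto
  qed
qed

section \<open>The quantitative bound for fixed n\<close>

lemma card_prod_div_le:
  fixes F F' y y' :: real
  assumes "0 < y" "0 < y'" "0 \<le> F" "0 \<le> F'" "F * y ^ k \<le> G" "F' * y' ^ k \<le> G'"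
    "G * G' \<le> (y * y') ^ k * (c * h)" "0 < c"
  shows "F * F' / c \<le> h"
proof -
  have "(F * y ^ k) * (F' * y' ^ k) \<le> G * G'" using assms by (intro mult_mono) (auto intro: order_trans[rotated])
  then have "(y * y') ^ k * (F * F') \<le> (y * y') ^ k * (c * h)"
    using assms(7) by (simp add: power_mult_distrib mult_ac)
  then have "F * F' \<le> c * h" using assms(1,2) by simp
  then show ?thesis using assms(8) by (simp add: field_simps)
qed

lemma sum_geometric_le:
  fixes A r :: real
  assumes A: "0 \<le> A" and r: "0 < r" "r < 1" and I: "finite I" "\<And>k. k \<in> I \<Longrightarrow> m \<le> k"
    and f: "\<And>k. k \<in> I \<Longrightarrow> f k \<le> A * r ^ k"
  shows "(\<Sum>k\<in>I. f k) \<le> A * r ^ m / (1 - r)"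
proof -
  have s: "summable (\<lambda>k. A * r ^ m * r ^ k)" using r by (intro summable_mult summable_geometric) auto
  have "(\<Sum>k\<in>I. f k) \<le> (\<Sum>k\<in>I. A * r ^ m * r ^ (k - m))"
  proof (rule sum_mono)
    fix k assume k: "k \<in> I"
    have "r ^ k = r ^ m * r ^ (k - m)" using I(2)[OF k] by (simp flip: power_add)
    then show "f k \<le> A * r ^ m * r ^ (k - m)" using f[OF k] by (simp only: mult.assoc)
  qed
  also have "\<dots> = (\<Sum>j\<in>(\<lambda>k. k - m) ` I. A * r ^ m * r ^ j)"
    using I(2) by (subst sum.reindex) (auto simp: inj_on_def eq_diff_iff)
  also have "\<dots> \<le> (\<Sum>j. A * r ^ m * r ^ j)"
    using A r I(1) by (intro sum_le_suminf[OF s]) auto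
  also have "\<dots> = A * r ^ m * (1 / (1 - r))"
    using r by (subst suminf_mult) (auto simp: suminf_geometric)
  finally show ?thesis by simp
qed

text \<open>An explicit error for one \<open>n\<close>, ready for a choice of \<open>K\<close> and
  then \<open>\<delta>\<close>. The number \<open>\<delta>\<close> bounds the evaluation points for
  sizes up to \<open>K\<close>, so \<open>\<delta> * A\<close> can serve as \<open>\<beta>\<close>
  in \<open>truncated_poisson\<close>; the geometric tail beyond \<open>K\<close> gives the last
  term.\<close>

lemma poisson_bound:
  fixes \<epsilon> B \<delta> :: real and p q :: "nat \<Rightarrow> nat"
  assumes p: "p permutes {1..n}" and q: "q permutes {1..n}"
    and \<epsilon>: "0 < \<epsilon>" "\<epsilon> \<le> 1" and B: "0 < B"
    and dd: "real (cycle_count n p 2) + real (cycle_count n q 2) \<le> (1 - \<epsilon>) * real n"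
    and prod: "real (cycle_count n p 1) * real (cycle_count n q 1) \<le> B * real n"
      "(real (cycle_count n p 1))\<^sup>2 * real (cycle_count n q 2) \<le> B\<^sup>2 * (real n)\<^sup>2"
      "(real (cycle_count n q 1))\<^sup>2 * real (cycle_count n p 2) \<le> B\<^sup>2 * (real n)\<^sup>2"
    and cube: "real (cycle_count n p 1) ^ 3 \<le> (\<epsilon> / 60) ^ 3 * (real n)\<^sup>2"
      "real (cycle_count n q 1) ^ 3 \<le> (\<epsilon> / 60) ^ 3 * (real n)\<^sup>2"
    and n: "1 \<le> (\<epsilon> / 60) ^ 3 * real n"
    and K: "4 * K \<le> n" and \<delta>: "0 < \<delta>" "2 * real K / real n \<le> \<delta>\<^sup>2" "1 / real n \<le> \<delta> ^ 3"
  defines "A \<equiv> exp (60 * B / \<epsilon> + 3600 * B\<^sup>2 / \<epsilon>\<^sup>2 + 2) * 40 / \<epsilon>" and "r \<equiv> exp (- (\<epsilon> / 40))"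
    and "S \<equiv> {s. s permutes {1..n}}" and "N \<equiv> \<lambda>s. small_orbits n p (s \<circ> q \<circ> inv s)"
  shows "\<bar>real (card {s \<in> S. N s = 0}) / fact n - exp (- ((\<Sum>s\<in>S. real (N s)) / fact n))\<bar>
    \<le> (2 * real K ^ 2 * (\<delta> * A) + real K ^ 2 * 4 ^ K / real n) * (A / (1 - r)) + 2 * (A * r ^ K / (1 - r))"
proof -
  interpret P: perm_pair "{1..n}" p q K
    by unfold_locales (use p q in auto)
  let ?U = "{1..n}"
  have A0: "0 < A" unfolding A_def using \<epsilon> by simp
  have r: "0 < r" "r < 1" unfolding r_def using \<epsilon> by auto
  note cc = cycle_count_def
  have szp: "cycle_count n p 1 + 2 * cycle_count n p 2 \<le> n"
    using orbit_prod_le(2)[OF P.finU p, of 1] by (simp add: cc)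
  have szq: "cycle_count n q 1 + 2 * cycle_count n q 2 \<le> n"
    using orbit_prod_le(2)[OF P.finU q, of 1] by (simp add: cc)
  have Gp: "real (card (inv_sets ?U p k)) * y ^ k \<le> gf_bound n (cycle_count n p 1) (cycle_count n p 2) y"
    if "0 < y" for y k
    using card_inv_sets_le(1)[OF P.finU p that, of k] by (simp add: cc)
  have Gq: "real (card (inv_sets ?U q k)) * y ^ k \<le> gf_bound n (cycle_count n q 1) (cycle_count n q 2) y"
    if "0 < y" for y k
    using card_inv_sets_le(1)[OF P.finU q that, of k] by (simp add: cc)
  have Gpx: "real (card {Z \<in> inv_sets ?U p k. x \<in> Z}) * y ^ k \<le> y * gf_bound n (cycle_count n p 1) (cycle_count n p 2) y"
    if "0 < y" "y \<le> 1" "x \<in> ?U" for y k x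
    using card_inv_sets_le(2)[OF P.finU p that, of k] by (simp add: cc)
  have Gqx: "real (card {Z \<in> inv_sets ?U q k. x \<in> Z}) * y ^ k \<le> y * gf_bound n (cycle_count n q 1) (cycle_count n q 2) y"
    if "0 < y" "y \<le> 1" "x \<in> ?U" for y k x
    using card_inv_sets_le(2)[OF P.finU q that, of k] by (simp add: cc)
  note saddle = saddle_point[OF _ _ \<epsilon> B szp szq dd prod cube n, folded A_def r_def]
  have M: "P.M k \<le> A * r ^ k" if k: "1 \<le> k" "2 * k \<le> n" for k
  proof -
    from saddle[OF k] obtain y y' where y: "0 < y" "0 < y'"
      "gf_bound n (cycle_count n p 1) (cycle_count n p 2) y * gf_bound n (cycle_count n q 1) (cycle_count n q 2) y'
        \<le> (y * y') ^ k * (real (n choose k) * (A * r ^ k))" by metis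
    have "0 < real (n choose k)" using k by simp
    from card_prod_div_le[OF y(1,2) _ _ Gp[OF y(1)] Gq[OF y(2)] y(3) this]
    show ?thesis unfolding P.M_def by simp
  qed
  have small: "y \<le> \<delta>" if "0 < y" "k \<le> K" "y\<^sup>2 \<le> 2 * real k / real n \<or> y ^ 3 \<le> 1 / real n" for y :: real and k
    using that(3)
  proof
    assume "y\<^sup>2 \<le> 2 * real k / real n"
    also have "\<dots> \<le> 2 * real K / real n" using that(2) by (intro divide_right_mono) auto
    finally have "y\<^sup>2 \<le> \<delta>\<^sup>2" using \<delta>(2) by linarith
    then show ?thesis by (rule power2_le_imp_le) (use \<delta>(1) in simp)
  next
    assume "y ^ 3 \<le> 1 / real n"
    then have "y ^ 3 \<le> \<delta> ^ 3" using \<delta>(3) by linarith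
    then show ?thesis using \<delta>(1) that(1) by (subst (asm) power_mono_iff) auto
  qed
  have Ar: "A * r ^ k \<le> A" for k using A0 r by (simp add: power_le_one mult_left_le)
  \<comment> \<open>Prescribing a point multiplies one generating function by its evaluation point,
    which is at most \<open>\<delta>\<close>.\<close>
  have \<beta>: "real (card {Z \<in> inv_sets ?U p k. x \<in> Z}) * real (card (inv_sets ?U q k)) / real (n choose k) \<le> \<delta> * A"
      "real (card (inv_sets ?U p k)) * real (card {Z \<in> inv_sets ?U q k. x \<in> Z}) / real (n choose k) \<le> \<delta> * A"
    if k: "1 \<le> k" "k \<le> K" and x: "x \<in> ?U" for k x
  proof -
    have k2: "2 * k \<le> n" using k K by simp
    let ?g = "\<lambda>y. gf_bound n (cycle_count n p 1) (cycle_count n p 2) y"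
    let ?h = "\<lambda>y. gf_bound n (cycle_count n q 1) (cycle_count n q 2) y"
    from saddle[OF k(1) k2] obtain y y' where y: "0 < y" "y \<le> 1" "0 < y'" "y' \<le> 1"
      "y\<^sup>2 \<le> 2 * real k / real n \<or> y ^ 3 \<le> 1 / real n" "y'\<^sup>2 \<le> 2 * real k / real n \<or> y' ^ 3 \<le> 1 / real n"
      "?g y * ?h y' \<le> (y * y') ^ k * (real (n choose k) * (A * r ^ k))" by metis
    have yd: "y \<le> \<delta>" "y' \<le> \<delta>" using small[OF y(1) k(2) y(5)] small[OF y(3) k(2) y(6)] by auto
    have pos: "0 < real (n choose k)" using k2 by simp
    have step: "z * (?g y * ?h y') \<le> (y * y') ^ k * (real (n choose k) * (\<delta> * A))" if z: "0 < z" "z \<le> \<delta>" for z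
    proof -
      have "z * (?g y * ?h y') \<le> \<delta> * ((y * y') ^ k * (real (n choose k) * (A * r ^ k)))"
        by (rule mult_mono[OF z(2) y(7)])
          (use \<delta>(1) y(1,3) in \<open>auto intro!: less_imp_le mult_pos_pos gf_bound_pos\<close>)
      also have "\<dots> \<le> \<delta> * ((y * y') ^ k * (real (n choose k) * A))"
        using \<delta>(1) y(1,3) Ar by (intro mult_left_mono) auto
      finally show ?thesis by (simp only: mult_ac)
    qed
    show "real (card {Z \<in> inv_sets ?U p k. x \<in> Z}) * real (card (inv_sets ?U q k)) / real (n choose k) \<le> \<delta> * A"
      using step[OF y(1) yd(1)] y(1,3) pos
      by (intro card_prod_div_le[OF y(1,3) _ _ Gpx[OF y(1,2) x] Gq[OF y(3)]]) (auto simp: mult_ac)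
    show "real (card (inv_sets ?U p k)) * real (card {Z \<in> inv_sets ?U q k. x \<in> Z}) / real (n choose k) \<le> \<delta> * A"
      using step[OF y(3) yd(2)] y(1,3) pos
      by (intro card_prod_div_le[OF y(1,3) _ _ Gp[OF y(1)] Gqx[OF y(3,4) x]]) (auto simp: mult_ac)
  qed
  \<comment> \<open>Pairs of orbits involve sizes up to \<open>2 * K\<close>;
    \<open>4 * K \<le> n\<close> keeps these within the range where the bound on \<open>P.M\<close>
    holds.\<close>
  have L: "(\<Sum>k=1..2*K. P.M k) \<le> A * r ^ 0 / (1 - r)"
    using A0 r K M by (intro sum_geometric_le) auto
  have fin: "finite {k. K < k \<and> real k \<le> real n / 2}"
    by (rule finite_subset[of _ "{..n}"]) auto
  have T: "(\<Sum>k | K < k \<and> real k \<le> real n / 2. P.M k) \<le> A * r ^ K / (1 - r)"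
    using A0 r M by (intro sum_geometric_le fin) auto
  have cU: "card {1..n} = n" by simp
  have Kn: "real K \<le> real n / 2" using K by simp
  have N: "N s = card {X \<in> P.orbs s. real (card X) \<le> real n / 2}" for s
    unfolding N_def small_orbits_def P.orbs_def P.cj_def ..
  have S: "S = P.S" unfolding S_def P.S_def ..
  have "\<bar>real (card {s \<in> S. N s = 0}) / fact n - exp (- ((\<Sum>s\<in>S. real (N s)) / fact n))\<bar>
      \<le> (2 * real K ^ 2 * (\<delta> * A) + real K ^ 2 * 4 ^ K / real n) * (\<Sum>k=1..2*K. P.M k)
        + 2 * (\<Sum>k | K < k \<and> real k \<le> real n / 2. P.M k)"
    unfolding N S
    by (rule P.truncated_poisson[OF Kn, unfolded cU]) (use \<beta> \<delta>(1) A0 in auto)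
  also have "\<dots> \<le> (2 * real K ^ 2 * (\<delta> * A) + real K ^ 2 * 4 ^ K / real n) * (A / (1 - r)) + 2 * (A * r ^ K / (1 - r))"
    using L T A0 \<delta>(1) by (intro add_mono mult_left_mono) auto
  finally show ?thesis .
qed

section \<open>Averaging over conjugacy classes\<close>

lemma conj_comp:
  assumes "s permutes U" "t permutes U"
  shows "s \<circ> (t \<circ> p \<circ> inv t) \<circ> inv s = (s \<circ> t) \<circ> p \<circ> inv (s \<circ> t)"
  using permutes_bij[OF assms(1)] permutes_bij[OF assms(2)] by (simp add: o_inv_distrib comp_assoc)

lemma conj_eq_iff:
  assumes "t permutes U"
  shows "t \<circ> x \<circ> inv t = t \<circ> y \<circ> inv t \<longleftrightarrow> x = y"
proof
  assume "t \<circ> x \<circ> inv t = t \<circ> y \<circ> inv t"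
  then have "inv t (t (x (inv t (t z)))) = inv t (t (y (inv t (t z))))" for z
    by (metis comp_apply)
  then show "x = y" using permutes_inverses[OF assms] by auto
qed simp

lemma finite_conj_class: "finite (conj_class n p)"
proof -
  have "conj_class n p = (\<lambda>s. s \<circ> p \<circ> inv s) ` {s. s permutes {1..n}}" by (auto simp: conj_class_def)
  then show ?thesis using finite_permutations[of "{1..n}"] by simp
qed

text \<open>The fibres of \<open>s \<mapsto> s \<circ> p \<circ> inv s\<close> are translates of the
  centraliser of \<open>p\<close>, hence of equal size. Conjugating by a uniform permutation thus
  gives a uniform element of the class.\<close>

lemma sum_conj_class:
  fixes F :: "(nat \<Rightarrow> nat) \<Rightarrow> real"
  shows "(\<Sum>x\<in>conj_class n p. F x) / real (card (conj_class n p))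
    = (\<Sum>s | s permutes {1..n}. F (s \<circ> p \<circ> inv s)) / fact n"
    and "card (conj_class n p) > 0"
proof -
  let ?S = "{s. s permutes {1..n}}" and ?C = "conj_class n p"
  have finS: "finite ?S" by (simp add: finite_permutations)
  have C: "?C = (\<lambda>s. s \<circ> p \<circ> inv s) ` ?S" by (auto simp: conj_class_def)
  have fib: "card {s \<in> ?S. s \<circ> p \<circ> inv s = x} = card {s \<in> ?S. s \<circ> p \<circ> inv s = p}"
    if x: "x \<in> ?C" for x
  proof -
    from x obtain t where t: "t permutes {1..n}" "x = t \<circ> p \<circ> inv t" by (auto simp: conj_class_def)
    have "(\<Sum>s\<in>?S. if s \<circ> p \<circ> inv s = p then 1 else 0) =
        (\<Sum>s\<in>?S. if (t \<circ> s) \<circ> p \<circ> inv (t \<circ> s) = x then 1 else (0::nat))"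
    proof (rule sum.cong[OF refl])
      fix s assume "s \<in> ?S"
      then have "(t \<circ> s) \<circ> p \<circ> inv (t \<circ> s) = t \<circ> (s \<circ> p \<circ> inv s) \<circ> inv t"
        using conj_comp[OF t(1), of s p] by simp
      then show "(if s \<circ> p \<circ> inv s = p then 1 else (0::nat)) =
          (if (t \<circ> s) \<circ> p \<circ> inv (t \<circ> s) = x then 1 else 0)"
        unfolding t(2) by (simp only: conj_eq_iff[OF t(1)])
    qed
    also have "\<dots> = (\<Sum>s\<in>?S. if s \<circ> p \<circ> inv s = x then 1 else 0)"
      by (rule sum.reindex_bij_betw[OF permutes_comp_left_bij[OF t(1)]])
    finally show ?thesis using finS by (simp add: sum.If_cases Int_def)
  qed
  define m where "m = card {s \<in> ?S. s \<circ> p \<circ> inv s = p}"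
  have *: "(\<Sum>s\<in>?S. G (s \<circ> p \<circ> inv s)) = real m * (\<Sum>x\<in>?C. G x)" for G :: "(nat \<Rightarrow> nat) \<Rightarrow> real"
  proof -
    have "(\<Sum>s\<in>?S. G (s \<circ> p \<circ> inv s)) = (\<Sum>x\<in>?C. \<Sum>s\<in>{s \<in> ?S. s \<circ> p \<circ> inv s = x}. G (s \<circ> p \<circ> inv s))"
      unfolding C by (rule sum.image_gen[OF finS])
    also have "\<dots> = (\<Sum>x\<in>?C. real m * G x)"
    proof (rule sum.cong[OF refl])
      fix x assume "x \<in> ?C"
      have "(\<Sum>s\<in>{s \<in> ?S. s \<circ> p \<circ> inv s = x}. G (s \<circ> p \<circ> inv s)) = (\<Sum>s\<in>{s \<in> ?S. s \<circ> p \<circ> inv s = x}. G x)"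
        by (rule sum.cong) auto
      then show "(\<Sum>s\<in>{s \<in> ?S. s \<circ> p \<circ> inv s = x}. G (s \<circ> p \<circ> inv s)) = real m * G x"
        using fib[OF \<open>x \<in> ?C\<close>] by (simp add: m_def)
    qed
    finally show ?thesis by (simp add: sum_distrib_left)
  qed
  have cardS: "card ?S = fact n" by (simp add: card_permutations)
  \<comment> \<open>The constant function 1 gives the orbit-stabiliser identity.\<close>
  have n: "fact n = real m * real (card ?C)" using *[of "\<lambda>_. 1"]
    by (simp only: sum_constant cardS of_nat_fact mult_1_right)
  then have m: "real m \<noteq> 0" "real (card ?C) \<noteq> 0" by (metis fact_nonzero mult_eq_0_iff)+
  then show "card ?C > 0" by simp
  show "(\<Sum>x\<in>?C. F x) / real (card ?C) = (\<Sum>s\<in>?S. F (s \<circ> p \<circ> inv s)) / fact n"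
    unfolding *[of F] n mult_divide_mult_cancel_left[OF m(1)] ..
qed

text \<open>Conjugating every generator by \<open>s\<close> only relabels points. Each inclusion
  pushes or pulls an invariant set along \<open>s\<close>.\<close>

lemma gen_orbit_conj:
  assumes "s permutes U"
  shows "gen_orbit ((\<lambda>f. s \<circ> f \<circ> inv s) ` F) (s x) = s ` gen_orbit F x"
proof
  let ?F = "(\<lambda>f. s \<circ> f \<circ> inv s) ` F"
  note s = permutes_inverses[OF assms]
  have "f z \<in> gen_orbit F x" if "f \<in> F" "z \<in> gen_orbit F x" for f z
    using invariantD[OF invariant_gen_orbit that] .
  then have "invariant ?F (s ` gen_orbit F x)" by (auto simp: invariant_def s)
  then show "gen_orbit ?F (s x) \<subseteq> s ` gen_orbit F x"
    by (rule gen_orbit_subset) (use gen_orbit_refl in auto)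
  have "invariant F {z. s z \<in> gen_orbit ?F (s x)}"
  proof -
    have "s (f z) \<in> gen_orbit ?F (s x)" if "f \<in> F" "s z \<in> gen_orbit ?F (s x)" for f z
      using invariantD[OF invariant_gen_orbit[of ?F "s x"], of "s \<circ> f \<circ> inv s" "s z"] that s by simp
    then show ?thesis by (auto simp: invariant_def)
  qed
  then have "gen_orbit F x \<subseteq> {z. s z \<in> gen_orbit ?F (s x)}"
    by (rule gen_orbit_subset) (simp add: gen_orbit_refl)
  then show "s ` gen_orbit F x \<subseteq> gen_orbit ?F (s x)" by auto
qed

lemma small_orbits_conj:
  assumes "s permutes {1..n}"
  shows "small_orbits n (s \<circ> p \<circ> inv s) (s \<circ> q \<circ> inv s) = small_orbits n p q"
proof -
  let ?F = "(\<lambda>f. s \<circ> f \<circ> inv s) ` {p, q}"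
  have "gen_orbits ?F {1..n} = gen_orbit ?F ` s ` {1..n}"
    unfolding gen_orbits_def permutes_image[OF assms] ..
  also have "\<dots> = (`) s ` gen_orbits {p, q} {1..n}"
    unfolding gen_orbits_def image_image gen_orbit_conj[OF assms] ..
  finally have G: "gen_orbits ?F {1..n} = (`) s ` gen_orbits {p, q} {1..n}" .
  have inj: "inj s" using permutes_inj[OF assms] .
  have c: "card (s ` X) = card X" for X using inj_on_subset[OF inj] by (intro card_image) simp
  have "{X \<in> gen_orbits ?F {1..n}. real (card X) \<le> real n / 2}
      = (`) s ` {X \<in> gen_orbits {p, q} {1..n}. real (card X) \<le> real n / 2}"
    unfolding G using c by auto
  moreover have "inj ((`) s)" using inj by (simp add: inj_image_eq_iff inj_on_def)
  ultimately show ?thesis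
    unfolding small_orbits_def by (simp add: card_image inj_on_subset[OF _ subset_UNIV])
qed

text \<open>Draw the two elements by conjugating \<open>p\<close> with \<open>s\<close> and
  \<open>q\<close> with \<open>t\<close>. Since \<open>s \<circ> t\<close> is as uniform as
  \<open>t\<close>, a simultaneous conjugation removes \<open>s\<close>. The function
  \<open>f\<close> is general so that both the probability and the mean are covered.\<close>

lemma conj_classes_average:
  fixes f :: "nat \<Rightarrow> real"
  assumes p: "p permutes {1..n}" and q: "q permutes {1..n}"
  defines "C \<equiv> conj_class n p" and "C' \<equiv> conj_class n q"
  shows "(\<Sum>(x, y)\<in>C \<times> C'. f (small_orbits n x y)) / real (card (C \<times> C'))
    = (\<Sum>s | s permutes {1..n}. f (small_orbits n p (s \<circ> q \<circ> inv s))) / fact n"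
proof -
  let ?S = "{s. s permutes {1..n}}"
  have inner: "(\<Sum>t\<in>?S. f (small_orbits n (s \<circ> p \<circ> inv s) (t \<circ> q \<circ> inv t)))
      = (\<Sum>t\<in>?S. f (small_orbits n p (t \<circ> q \<circ> inv t)))" if s: "s \<in> ?S" for s
  proof -
    have sp: "s permutes {1..n}" using s by simp
    have "(\<Sum>t\<in>?S. f (small_orbits n (s \<circ> p \<circ> inv s) (t \<circ> q \<circ> inv t)))
        = (\<Sum>t\<in>?S. f (small_orbits n (s \<circ> p \<circ> inv s) ((s \<circ> t) \<circ> q \<circ> inv (s \<circ> t))))"
      by (rule sum.reindex_bij_betw[OF permutes_comp_left_bij[OF sp], symmetric])
    also have "\<dots> = (\<Sum>t\<in>?S. f (small_orbits n p (t \<circ> q \<circ> inv t)))"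
    proof (rule sum.cong[OF refl])
      fix t assume "t \<in> ?S"
      then have t: "t permutes {1..n}" by simp
      show "f (small_orbits n (s \<circ> p \<circ> inv s) ((s \<circ> t) \<circ> q \<circ> inv (s \<circ> t))) = f (small_orbits n p (t \<circ> q \<circ> inv t))"
        unfolding conj_comp[OF sp t, symmetric] small_orbits_conj[OF sp] ..
    qed
    finally show ?thesis .
  qed
  have "(\<Sum>(x, y)\<in>C \<times> C'. f (small_orbits n x y)) / real (card (C \<times> C'))
      = (\<Sum>x\<in>C. (\<Sum>y\<in>C'. f (small_orbits n x y)) / real (card C')) / real (card C)"
    by (simp add: sum.cartesian_product[symmetric] card_cartesian_product sum_divide_distrib[symmetric] mult.commute)
  also have "\<dots> = (\<Sum>x\<in>C. (\<Sum>t\<in>?S. f (small_orbits n x (t \<circ> q \<circ> inv t))) / fact n) / real (card C)"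
    unfolding C'_def by (simp only: sum_conj_class(1)[of _ n q])
  also have "\<dots> = (\<Sum>s\<in>?S. (\<Sum>t\<in>?S. f (small_orbits n (s \<circ> p \<circ> inv s) (t \<circ> q \<circ> inv t))) / fact n) / fact n"
    unfolding C_def by (rule sum_conj_class(1)[of _ n p])
  also have "\<dots> = (\<Sum>s\<in>?S. (\<Sum>t\<in>?S. f (small_orbits n p (t \<circ> q \<circ> inv t))) / fact n) / fact n"
    by (rule arg_cong[of _ _ "\<lambda>x. x / fact n"], rule sum.cong[OF refl], simp only: inner)
  also have "\<dots> = (\<Sum>t\<in>?S. f (small_orbits n p (t \<circ> q \<circ> inv t))) / fact n"
    by (simp add: card_permutations)
  finally show ?thesis .
qed

lemma prob_N0_exp_N_average:
  assumes p: "p permutes {1..n}" and q: "q permutes {1..n}"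
  defines "N \<equiv> \<lambda>s. small_orbits n p (s \<circ> q \<circ> inv s)"
  shows "prob_N0 n (conj_class n p) (conj_class n q) = real (card {s. s permutes {1..n} \<and> N s = 0}) / fact n"
    and "exp_N n (conj_class n p) (conj_class n q) = (\<Sum>s | s permutes {1..n}. real (N s)) / fact n"
proof -
  let ?C = "conj_class n p \<times> conj_class n q"
  show "exp_N n (conj_class n p) (conj_class n q) = (\<Sum>s | s permutes {1..n}. real (N s)) / fact n"
    using conj_classes_average[OF p q, of real] by (simp add: exp_N_def N_def)
  have fin: "finite ?C" by (simp add: finite_conj_class)
  have "real (card {(x, y) \<in> ?C. small_orbits n x y = 0}) = (\<Sum>(x, y)\<in>?C. of_bool (small_orbits n x y = 0))"
  proof -
    have "{(x, y) \<in> ?C. small_orbits n x y = 0} = {z \<in> ?C. small_orbits n (fst z) (snd z) = 0}" by auto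
    then show ?thesis using fin
      by (simp add: case_prod_unfold of_bool_def sum.If_cases Int_def)
  qed
  moreover have "real (card {s. s permutes {1..n} \<and> N s = 0}) = (\<Sum>s | s permutes {1..n}. of_bool (N s = 0))"
    using finite_permutations[of "{1..n}"] by (simp add: of_bool_def sum.If_cases Int_def)
  ultimately show "prob_N0 n (conj_class n p) (conj_class n q) = real (card {s. s permutes {1..n} \<and> N s = 0}) / fact n"
    using conj_classes_average[OF p q, of "\<lambda>x. of_bool (x = 0)"] by (simp add: prob_N0_def N_def)
qed

text \<open>Justifies the choice inside \<open>class_cycles\<close>: the chosen element lies in the
  class and generates it, so the same element can represent the class in the probabilistic
  argument.\<close>

lemma conj_class_representative:
  assumes "is_conj_class n C"
  defines "p \<equiv> SOME p. p \<in> C"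
  shows "p permutes {1..n}" "C = conj_class n p"
proof -
  from assms obtain t where t: "t permutes {1..n}" "C = conj_class n t" by (auto simp: is_conj_class_def)
  have "t = id \<circ> t \<circ> inv id" by simp
  then have "t \<in> C" unfolding t(2) conj_class_def using permutes_id by blast
  then have "p \<in> C" unfolding p_def by (rule someI[where P = "\<lambda>p. p \<in> C"])
  then obtain s where s: "s permutes {1..n}" "p = s \<circ> t \<circ> inv s" by (auto simp: t(2) conj_class_def)
  show "p permutes {1..n}" unfolding s(2) using s(1) t(1) by (intro permutes_compose permutes_inv)
  have "conj_class n p = (\<lambda>u. u \<circ> p \<circ> inv u) ` {u. u permutes {1..n}}" by (auto simp: conj_class_def)
  also have "\<dots> = (\<lambda>u. (u \<circ> s) \<circ> t \<circ> inv (u \<circ> s)) ` {u. u permutes {1..n}}"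
    unfolding s(2) using conj_comp[OF _ s(1)] by (intro image_cong) auto
  also have "\<dots> = (\<lambda>u. u \<circ> t \<circ> inv u) ` (\<lambda>u. u \<circ> s) ` {u. u permutes {1..n}}"
    by (simp add: image_image)
  also have "(\<lambda>u. u \<circ> s) ` {u. u permutes {1..n}} = {u. u permutes {1..n}}"
    using permutes_comp_right_bij[OF s(1)] by (simp add: bij_betw_def)
  also have "(\<lambda>u. u \<circ> t \<circ> inv u) ` {u. u permutes {1..n}} = C" by (auto simp: t(2) conj_class_def)
  finally show "C = conj_class n p" by simp
qed

section \<open>Passage to the limit\<close>

lemma eventually_real_ge: "\<forall>\<^sub>F n in sequentially. x \<le> real n"
  using filterlim_real_sequentially by (auto simp: filterlim_at_top)

theorem theorem3p10:
  fixes C C' :: "nat \<Rightarrow> (nat \<Rightarrow> nat) set"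
  defines "c \<equiv> \<lambda>n j. class_cycles n (C n) j"
      and "c' \<equiv> \<lambda>n j. class_cycles n (C' n) j"
  assumes classes: "\<And>n. is_conj_class n (C n) \<and> is_conj_class n (C' n)"
    and fixed_pts: "(\<lambda>n. real (c n 1 + c' n 1)) \<in> o(\<lambda>n. real n powr (2/3))"
    and prod_bound: "(\<lambda>n. (real (c n 1) + sqrt (real (c n 2))) * (real (c' n 1) + sqrt (real (c' n 2))))
                       \<in> O(\<lambda>n. real n)"
    and two_cycles: "\<exists>\<epsilon>>0. \<forall>n. real (c n 2 + c' n 2) \<le> (1 - \<epsilon>) * real n"
  shows "(\<lambda>n. prob_N0 n (C n) (C' n) - exp (- exp_N n (C n) (C' n))) \<longlonglongrightarrow> 0"
proof (rule tendstoI)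
  fix e :: real assume e: "0 < e"
  \<comment> \<open>Capping the constant at 1 weakens the hypothesis on 2-cycles and meets the range
    required by \<open>saddle_point\<close>.\<close>
  obtain \<epsilon> where \<epsilon>: "0 < \<epsilon>" "\<epsilon> \<le> 1" and dd: "\<And>n. real (c n 2) + real (c' n 2) \<le> (1 - \<epsilon>) * real n"
  proof -
    obtain \<epsilon>0 where e0: "0 < \<epsilon>0" "\<forall>n. real (c n 2 + c' n 2) \<le> (1 - \<epsilon>0) * real n" using two_cycles by blast
    have "real (c n 2) + real (c' n 2) \<le> (1 - min \<epsilon>0 1) * real n" for n
    proof -
      have "(1 - \<epsilon>0) * real n \<le> (1 - min \<epsilon>0 1) * real n" by (intro mult_right_mono) auto
      then show ?thesis using e0(2)[rule_format, of n] by simp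
    qed
    then show thesis using e0(1) by (intro that[of "min \<epsilon>0 1"]) auto
  qed
  obtain B where B: "0 < B" and uv: "\<forall>\<^sub>F n in sequentially.
      norm ((real (c n 1) + sqrt (real (c n 2))) * (real (c' n 1) + sqrt (real (c' n 2)))) \<le> B * norm (real n)"
    using landau_o.bigE[OF prod_bound] by blast
  define \<eta> where "\<eta> = \<epsilon> / 60"
  have \<eta>: "0 < \<eta>" using \<epsilon> by (simp add: \<eta>_def)
  have fx: "\<forall>\<^sub>F n in sequentially. norm (real (c n 1 + c' n 1)) \<le> \<eta> * norm (real n powr (2/3))"
    using landau_o.smallD[OF fixed_pts \<eta>] .
  define A where "A = exp (60 * B / \<epsilon> + 3600 * B\<^sup>2 / \<epsilon>\<^sup>2 + 2) * 40 / \<epsilon>"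
  define r where "r = exp (- (\<epsilon> / 40))"
  have A: "0 < A" using \<epsilon> by (simp add: A_def)
  have r: "0 < r" "r < 1" using \<epsilon> by (auto simp: r_def)
  define G where "G = A / (1 - r)"
  have G: "0 < G" using A r by (simp add: G_def)
  have "(\<lambda>K. 2 * (G * r ^ K)) \<longlonglongrightarrow> 2 * (G * 0)"
    using r by (intro tendsto_intros LIMSEQ_power_zero) auto
  from order_tendstoD(2)[OF this, of "e / 3"] have "\<forall>\<^sub>F K in sequentially. 2 * (G * r ^ K) < e / 3"
    using e by simp
  \<comment> \<open>The cutoff \<open>K\<close> is fixed first, making the tail less than
    \<open>e / 3\<close>. Next \<open>\<delta>\<close> handles the hitting term, and finally large
    \<open>n\<close> handles the term with \<open>1 / n\<close>.\<close>
  then obtain K where K: "2 * (G * r ^ K) < e / 3" by (meson eventually_happens trivial_limit_sequentially)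
  \<comment> \<open>The summand 1 keeps \<open>D\<close> positive when \<open>K = 0\<close>.\<close>
  define D where "D = 2 * real K ^ 2 * A * G + 1"
  have D: "0 < D" using A G by (simp add: D_def add_nonneg_pos)
  define \<delta> where "\<delta> = e / (3 * D)"
  have \<delta>: "0 < \<delta>" using e D by (simp add: \<delta>_def)
  have big: "\<forall>\<^sub>F n in sequentially. max (max (1 / \<eta> ^ 3) (2 * real K / \<delta>\<^sup>2))
      (max (max (1 / \<delta> ^ 3) (4 * real K)) (3 * (real K ^ 2 * 4 ^ K * G + 1) / e)) \<le> real n"
    by (rule eventually_real_ge)
  from uv fx big show "\<forall>\<^sub>F n in sequentially. dist (prob_N0 n (C n) (C' n) - exp (- exp_N n (C n) (C' n))) 0 < e"
  proof eventually_elim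
    case (elim n)
    have n: "1 / \<eta> ^ 3 \<le> real n" "2 * real K / \<delta>\<^sup>2 \<le> real n" "1 / \<delta> ^ 3 \<le> real n" "4 * real K \<le> real n"
      "3 * (real K ^ 2 * 4 ^ K * G + 1) / e \<le> real n" using elim(3) by auto
    have n0: "0 < real n" using n(1) \<eta> by (meson less_le_trans zero_less_divide_1_iff zero_less_power)
    define p where "p = (SOME p. p \<in> C n)"
    define q where "q = (SOME q. q \<in> C' n)"
    have p: "p permutes {1..n}" "C n = conj_class n p"
      using conj_class_representative[of n "C n"] classes unfolding p_def by auto
    have q: "q permutes {1..n}" "C' n = conj_class n q"
      using conj_class_representative[of n "C' n"] classes unfolding q_def by auto
    have c: "c n j = cycle_count n p j" "c' n j = cycle_count n q j" for j
      by (simp_all add: c_def c'_def class_cycles_def p_def q_def)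
    let ?a = "real (cycle_count n p 1)" and ?d = "real (cycle_count n p 2)"
    let ?a' = "real (cycle_count n q 1)" and ?d' = "real (cycle_count n q 2)"
    have nn: "0 \<le> ?a" "0 \<le> sqrt ?d" "0 \<le> ?a'" "0 \<le> sqrt ?d'" by auto
    have "(?a + sqrt ?d) * (?a' + sqrt ?d') \<le> \<bar>(?a + sqrt ?d) * (?a' + sqrt ?d')\<bar>" by (rule abs_ge_self)
    also have "\<dots> \<le> B * real n" using elim(1) unfolding c by simp
    finally have uvn: "(?a + sqrt ?d) * (?a' + sqrt ?d') \<le> B * real n" .
    \<comment> \<open>Each of the three product conditions comes from one term in the expansion of
      the assumed product; the two mixed terms are squared to remove the root.\<close>
    have p1: "?a * ?a' \<le> B * real n"
      using nn by (intro order_trans[OF mult_mono uvn]) auto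
    have "?a * sqrt ?d' \<le> B * real n"
      using nn by (intro order_trans[OF mult_mono uvn]) auto
    then have "(?a * sqrt ?d')\<^sup>2 \<le> (B * real n)\<^sup>2" using nn by (intro power_mono) auto
    then have p2: "?a\<^sup>2 * ?d' \<le> B\<^sup>2 * (real n)\<^sup>2" by (simp add: power_mult_distrib)
    have "sqrt ?d * ?a' \<le> B * real n"
      using nn by (intro order_trans[OF mult_mono uvn]) auto
    then have "(sqrt ?d * ?a')\<^sup>2 \<le> (B * real n)\<^sup>2" using nn by (intro power_mono) auto
    then have p3: "?a'\<^sup>2 * ?d \<le> B\<^sup>2 * (real n)\<^sup>2" by (simp add: power_mult_distrib mult.commute)
    have aa: "?a + ?a' \<le> \<eta> * real n powr (2/3)" using elim(2) unfolding c by simp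
    \<comment> \<open>Cubing turns the bound by \<open>n powr (2/3)\<close> into the form used for
      the unbalanced case.\<close>
    have cube: "x ^ 3 \<le> \<eta> ^ 3 * (real n)\<^sup>2" if "0 \<le> x" "x \<le> \<eta> * real n powr (2/3)" for x
    proof -
      have "x ^ 3 \<le> (\<eta> * real n powr (2/3)) ^ 3" using that by (intro power_mono) auto
      also have "\<dots> = \<eta> ^ 3 * (real n powr (2/3)) ^ 3" by (rule power_mult_distrib)
      also have "(real n powr (2/3)) ^ 3 = real n powr 2" using n0 by (simp add: powr_power)
      also have "\<dots> = (real n)\<^sup>2" by (rule powr_numeral) simp
      finally show ?thesis .
    qed
    have cp: "?a ^ 3 \<le> \<eta> ^ 3 * (real n)\<^sup>2" "?a' ^ 3 \<le> \<eta> ^ 3 * (real n)\<^sup>2"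
      using aa nn by (auto intro!: cube)
    have n1: "1 \<le> \<eta> ^ 3 * real n" using n(1) \<eta> by (simp add: field_simps)
    have K4: "4 * K \<le> n" using n(4) by linarith
    have d1: "2 * real K / real n \<le> \<delta>\<^sup>2" using n(2) \<delta> n0 by (simp add: field_simps)
    have d2: "1 / real n \<le> \<delta> ^ 3" using n(3) \<delta> n0 by (simp add: field_simps)
    have dd': "?d + ?d' \<le> (1 - \<epsilon>) * real n" using dd[of n] unfolding c .
    have "\<bar>prob_N0 n (C n) (C' n) - exp (- exp_N n (C n) (C' n))\<bar>
        \<le> (2 * real K ^ 2 * (\<delta> * A) + real K ^ 2 * 4 ^ K / real n) * G + 2 * (A * r ^ K / (1 - r))"
      using poisson_bound[OF p(1) q(1) \<epsilon> B dd' p1 p2 p3 cp[unfolded \<eta>_def] n1[unfolded \<eta>_def] K4 \<delta> d1 d2]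
      unfolding p(2) q(2) prob_N0_exp_N_average[OF p(1) q(1)] A_def[symmetric] r_def[symmetric] G_def[symmetric]
      by simp
    also have "\<dots> = \<delta> * (2 * real K ^ 2 * A * G) + real K ^ 2 * 4 ^ K * G / real n + 2 * (G * r ^ K)"
    proof -
      have "A * r ^ K / (1 - r) = G * r ^ K" by (simp add: G_def)
      then show ?thesis by (simp add: distrib_left distrib_right mult_ac)
    qed
    also have "\<dots> < e"
    proof -
      have "\<delta> * (2 * real K ^ 2 * A * G) \<le> \<delta> * D" using \<delta> by (intro mult_left_mono) (auto simp: D_def)
      also have "\<dots> = e / 3" using D by (simp add: \<delta>_def)
      finally have 1: "\<delta> * (2 * real K ^ 2 * A * G) \<le> e / 3" .
      have "3 * (real K ^ 2 * 4 ^ K * G + 1) \<le> real n * e" using n(5) e by (simp add: field_simps)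
      then have "real K ^ 2 * 4 ^ K * G / real n \<le> e / 3" using n0 by (simp add: field_simps)
      then show ?thesis using 1 K by linarith
    qed
    finally show ?case by simp
  qed
qed

end
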